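(* Let $k,\hat k$ be as in one of the two cases of the context (Raviart–Thomas: $\mathbf V_k=\mathbf{RT}_k$, $\hat k=k\ge 0$; Brezzi–Douglas–Marini: $\mathbf V_k=\mathbf{BDM}_k$, $\hat k=k-1\ge 0$). Assume $g=0$ and that $\boldsymbol u_h=(\boldsymbol u_{h,1},\boldsymbol u_{h,2})\in \mathbf V_{k,h}$ (together with a discrete pressure $p_h\in Q_{\hat k,h}$) satisfies $$\mathcal A(\boldsymbol u_h,\boldsymbol v_h)+\mathcal B(\boldsymbol v_h,p_h)=F(\boldsymbol v_h)\quad\forall \boldsymbol v_h\in \mathbf V_{k,h},\qquad \mathcal B(\boldsymbol u_h,q_h)=G(q_h)\quad\forall q_h\in Q_{\hat k,h}.$$ Then $\operatorname{div}\boldsymbol u_h=0$, i.e. $\operatorname{div}\boldsymbol u_{h,i}=0$ in $\Omega_{\mathcal T_{h,i}}$ for $i=1,2$.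
   Context: **Domain and data.** $\Omega\subset\mathbb R^d$, $d\in\{2,3\}$, is a bounded convex domain with polygonal boundary $\partial\Omega$; $\Gamma$ is a smooth interface separating $\Omega$ into two disjoint connected subdomains $\Omega_1,\Omega_2$ (written $\Omega=\Omega_1\cup\Omega_2$), with unit normal $\boldsymbol n=\boldsymbol n_1$ on $\Gamma$ pointing from $\Omega_1$ to $\Omega_2$; $\boldsymbol n$ also denotes the normal to $\partial\Omega$. $\partial\Omega=\partial\Omega_p\cup\partial\Omega_{\boldsymbol u}$ with $\partial\Omega_p\cap\partial\Omega_{\boldsymbol u}=\emptyset$. Data: $\mathbf f\in \mathbf L^2(\Omega_1\cup\Omega_2)$, $g\in L^2(\Omega_1\cup\Omega_2)$, $p_B\in H^{1/2}(\partial\Omega_p)$, $\hat p\in H^{1/2}(\Gamma)$, $\xi\in(0,1/4]$; $\boldsymbol\eta=\mathbf K^{-1}$ where the permeability tensor $\mathbf K$ is diagonal with smallest diagonal entry positive and bounded away from zero; $\boldsymbol\eta_\Gamma$ is a given nonnegative coefficient on $\Gamma$ depending on the permeability tensor in the fracture and the fracture thickness. The boundary condition $\boldsymbol u\cdot\boldsymbol n=0$ is prescribed on $\partial\Omega_{\boldsymbol u}$. **Notation.** For pairs $v=(v_1,v_2)$, $w=(w_1,w_2)$ (components may overlap near $\Gamma$): $(v,w)_{\Omega_1\cup\Omega_2}=\sum_{i=1}^2(v_i,w_i)_{\Omega_i}$ ($L^2$-inner products); on $\Gamma$, $[\![v]\!]=(v_1-v_2)|_\Gamma$ and $\{v\}=\tfrac12(v_1+v_2)|_\Gamma$.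 **Mesh.** $\{\mathcal T_h\}_h$ is a quasi-uniform family of simplicial meshes of $\Omega$, $h\in(0,h_0]$ with $h_0<1$ small ($h$ also denotes the piecewise constant function equal to the diameter $h_T$ on $T$). $\mathcal T_h$ conforms to $\partial\Omega$ but need not conform to $\Gamma$; when $\Gamma$ cuts an element it intersects the element boundary exactly twice and each open edge at most once. $\mathcal G_h=\{T\in\mathcal T_h:|\Gamma\cap T|>0\}$, $\mathcal F_h$ is the set of faces (edges) in $\mathcal G_h$, $\mathcal T_{h,i}=\{T\in\mathcal T_h:T\cap\Omega_i\ne\emptyset\}$, $\Omega_{\mathcal T_{h,i}}=\bigcup_{T\in\mathcal T_{h,i}}T$, and $\mathcal F_{h,i}$ is the set of faces in $\mathcal F_h$ shared by two elements of $\mathcal T_{h,i}$. **Spaces.** Either $\mathbf V_k=\mathbf{RT}_k$ (Raviart–Thomas) with $\hat k=k\ge0$, or $\mathbf V_k=\mathbf{BDM}_k$ (Brezzi–Douglas–Marini) with $\hat k=k-1\ge0$; $\mathbf V_k(T)$ is the corresponding local space on $T$, and $Q_{\hat k}(T)$ is the space of polynomials on $T$ of degree $\le\hat k$. $\mathbf V_k(\mathcal T_{h,i})=\{\boldsymbol v_h\in\mathbf H^{\operatorname{div}}(\Omega_{\mathcal T_{h,i}}):\boldsymbol v_h|_T\in\mathbf V_k(T)\ \forall T\in\mathcal T_{h,i},\ \boldsymbol v_h\cdot\boldsymbol n|_{\partial\Omega_{\boldsymbol u}}=0\}$; $Q_{\hat k}(\mathcal T_{h,i})=\bigoplus_{T\in\mathcal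 T_{h,i}}Q_{\hat k}(T)$; $\mathbf V_{k,h}=\{(\boldsymbol v_{h,1},\boldsymbol v_{h,2}):\boldsymbol v_{h,i}\in\mathbf V_k(\mathcal T_{h,i})\}$; $Q_{\hat k,h}=\{(q_{h,1},q_{h,2}):q_{h,i}\in Q_{\hat k}(\mathcal T_{h,i})\}$, with the additional constraint $\int_{\Omega_1\cup\Omega_2}q_h=0$ if $\partial\Omega_p=\emptyset$. **Forms.** $\mathcal A(\boldsymbol u,\boldsymbol v)=(\boldsymbol\eta\boldsymbol u,\boldsymbol v)_{\Omega_1\cup\Omega_2}+(\boldsymbol\eta_\Gamma\{\boldsymbol u\cdot\boldsymbol n\},\{\boldsymbol v\cdot\boldsymbol n\})_\Gamma+(\xi\boldsymbol\eta_\Gamma[\![\boldsymbol u\cdot\boldsymbol n]\!],[\![\boldsymbol v\cdot\boldsymbol n]\!])_\Gamma+s_{\boldsymbol u}(\boldsymbol u,\boldsymbol v)$, $\mathcal B(\boldsymbol u,q)=-(\operatorname{div}\boldsymbol u,q)_{\Omega_1\cup\Omega_2}-s_b(\boldsymbol u,q)$, $s_{\boldsymbol u}(\boldsymbol u,\boldsymbol v)=\sum_{i=1}^2\sum_{F\in\mathcal F_{h,i}}\sum_{j=0}^{\hat k+1}\tau_{\boldsymbol u}h^{2j+1}([\![D^j_{\boldsymbol n_F}\boldsymbol u_i]\!],[\![D^j_{\boldsymbol n_F}\boldsymbol v_i]\!])_F$, $s_b(\boldsymbol u,q)=\sum_{i=1}^2\sum_{F\in\mathcal F_{h,i}}\sum_{j=0}^{\hat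 k}\tau_bh^{2j+1}([\![D^j(\operatorname{div}\boldsymbol u_i)]\!],[\![D^jq_i]\!])_F$, where $[\![\cdot]\!]$ on a face $F$ is the jump across $F$, $D^j$ denotes the derivative of order $j$, $D^j_{\boldsymbol n_F}$ the normal derivative of order $j$ (applied componentwise, inner products summed over components), and $\tau_{\boldsymbol u},\tau_b>0$ are stabilization parameters which may vary with $j$ and $i$. $F(\boldsymbol v)=(\mathbf f,\boldsymbol v)_{\Omega_1\cup\Omega_2}-(p_B,\boldsymbol v\cdot\boldsymbol n)_{\partial\Omega_p}-(\hat p,[\![\boldsymbol v\cdot\boldsymbol n]\!])_\Gamma$, $G(q)=-(g,q)_{\Omega_1\cup\Omega_2}$.
   Formalization: When ∂Ω_p = ∅ (pressures constrained to mean zero), the formal theorem additionally assumes B(u_h,1) = G(1); without it the claim fails, e.g. for f = g = 0, p̂ = 1, where div u_h is a nonzero constant. Nothing is added when ∂Ω_p is nonempty. *)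

theory Defs
  imports "HOL-Analysis.Analysis"
begin

section \<open>Derivatives\<close>

definition dir_deriv ::
    "real ^ 'n \<Rightarrow> (real ^ 'n \<Rightarrow> 'b::real_normed_vector) \<Rightarrow> real ^ 'n \<Rightarrow> 'b" where
  "dir_deriv e f x = frechet_derivative f (at x) e"

abbreviation partial ::
    "'n \<Rightarrow> (real ^ 'n \<Rightarrow> 'b::real_normed_vector) \<Rightarrow> real ^ 'n \<Rightarrow> 'b" where
  "partial i \<equiv> dir_deriv (axis i 1)"

definition partials ::
    "'n list \<Rightarrow> (real ^ 'n \<Rightarrow> 'b::real_normed_vector) \<Rightarrow> real ^ 'n \<Rightarrow> 'b" where
  "partials is f = foldr partial is f"

definition grad :: "(real ^ 'n \<Rightarrow> real) \<Rightarrow> real ^ 'n \<Rightarrow> real ^ 'n" where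
  "grad f x = (\<chi> i. partial i f x)"

text \<open>The classical divergence.  For a piecewise smooth field it is used in the interior of each
  element; for a field in \<open>Hdiv\<close> (below) it represents the weak divergence almost everywhere.\<close>

definition dvg :: "(real ^ 'n \<Rightarrow> real ^ 'n) \<Rightarrow> real ^ 'n \<Rightarrow> real" where
  "dvg v x = (\<Sum>i\<in>UNIV. partial i (\<lambda>y. v y $ i) x)"

definition smooth_on :: "(real ^ 'n) set \<Rightarrow> (real ^ 'n \<Rightarrow> real) \<Rightarrow> bool" where
  "smooth_on U f \<longleftrightarrow> open U \<and> (\<forall>is. \<forall>x\<in>U. partials is f differentiable (at x))"


section \<open>Surface measure\<close>

text \<open>The \<open>s\<close>-dimensional Hausdorff (outer) measure (used for \<open>s > 0\<close> only), normalised so that it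
  is Lebesgue measure on flat \<open>s\<close>-dimensional pieces.\<close>

definition hausdorff_pre :: "real \<Rightarrow> real \<Rightarrow> 'a::metric_space set \<Rightarrow> ennreal" where
  "hausdorff_pre s \<delta> A =
     (INF U \<in> {U :: nat \<Rightarrow> 'a set. A \<subseteq> (\<Union>m. U m) \<and> (\<forall>m. bounded (U m) \<and> diameter (U m) \<le> \<delta>)}.
        \<Sum>m. ennreal (unit_ball_vol s * (diameter (U m) / 2) powr s))"

definition hausdorff_outer :: "real \<Rightarrow> 'a::metric_space set \<Rightarrow> ennreal" where
  "hausdorff_outer s A = (SUP \<delta>\<in>{0<..}. hausdorff_pre s \<delta> A)"

definition surf :: "(real ^ 'n) measure" where
  "surf = completion (measure_of UNIV (sets borel) (hausdorff_outer (real CARD('n) - 1)))"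


section \<open>Function spaces\<close>

definition L2_on :: "'a measure \<Rightarrow> 'a set \<Rightarrow> ('a \<Rightarrow> 'b::{second_countable_topology, banach}) \<Rightarrow> bool" where
  "L2_on M S f \<longleftrightarrow> set_borel_measurable M S f \<and> set_integrable M S (\<lambda>x. (norm (f x))\<^sup>2)"

text \<open>\<open>H\<^sup>1\<^sup>/\<^sup>2\<close> of a \<open>(d - 1)\<close>-dimensional surface by the Sobolev--Slobodeckij seminorm; the exponent
  of the kernel is \<open>(d - 1) + 2 (1/2) = d\<close>.\<close>

definition H_half :: "(real ^ 'n) set \<Rightarrow> (real ^ 'n \<Rightarrow> real) \<Rightarrow> bool" where
  "H_half S p \<longleftrightarrow> L2_on surf S p \<and>
     (\<integral>\<^sup>+x. (\<integral>\<^sup>+y. indicator S x * indicator S y *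
        ennreal ((p x - p y)\<^sup>2 / norm (x - y) ^ CARD('n)) \<partial>surf) \<partial>surf) < \<infinity>"

text \<open>Testing with compactly supported \<open>C\<^sup>1\<close> functions gives the same weak divergence as testing
  with compactly supported \<open>C\<^sup>\<infinity>\<close> functions.\<close>

definition test_fun :: "(real ^ 'n) set \<Rightarrow> (real ^ 'n \<Rightarrow> real) \<Rightarrow> bool" where
  "test_fun U \<phi> \<longleftrightarrow> (\<forall>x. \<phi> differentiable (at x)) \<and> continuous_on UNIV (grad \<phi>) \<and>
     compact (closure {x. \<phi> x \<noteq> 0}) \<and> closure {x. \<phi> x \<noteq> 0} \<subseteq> U"

definition has_weak_div ::
    "(real ^ 'n) set \<Rightarrow> (real ^ 'n \<Rightarrow> real ^ 'n) \<Rightarrow> (real ^ 'n \<Rightarrow> real) \<Rightarrow> bool" where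
  "has_weak_div U v w \<longleftrightarrow> (\<forall>\<phi>. test_fun U \<phi> \<longrightarrow>
     (LINT x:U|lebesgue. v x \<bullet> grad \<phi> x) = - (LINT x:U|lebesgue. w x * \<phi> x))"

definition Hdiv :: "(real ^ 'n) set \<Rightarrow> (real ^ 'n \<Rightarrow> real ^ 'n) \<Rightarrow> bool" where
  "Hdiv U v \<longleftrightarrow> L2_on lebesgue U v \<and> (\<exists>w. L2_on lebesgue U w \<and> has_weak_div U v w)"


section \<open>Polynomials and local finite element spaces\<close>

definition P_deg :: "nat \<Rightarrow> (real ^ 'n \<Rightarrow> real) set" where
  "P_deg k = {p. \<exists>c :: ('n \<Rightarrow> nat) \<Rightarrow> real.
     \<forall>x. p x = (\<Sum>\<alpha> | (\<Sum>i\<in>UNIV. \<alpha> i) \<le> k. c \<alpha> * (\<Prod>i\<in>UNIV. (x $ i) ^ \<alpha> i))}"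

definition BDM_loc :: "nat \<Rightarrow> (real ^ 'n \<Rightarrow> real ^ 'n) set" where
  "BDM_loc k = {v. \<forall>i. (\<lambda>x. v x $ i) \<in> P_deg k}"

definition RT_loc :: "nat \<Rightarrow> (real ^ 'n \<Rightarrow> real ^ 'n) set" where
  "RT_loc k = {v. \<exists>a\<in>BDM_loc k. \<exists>b\<in>P_deg k. \<forall>x. v x = a x + b x *\<^sub>R x}"

datatype fe_family = RT | BDM

fun V_loc :: "fe_family \<Rightarrow> nat \<Rightarrow> (real ^ 'n \<Rightarrow> real ^ 'n) set" where
  "V_loc RT k = RT_loc k"
| "V_loc BDM k = BDM_loc k"

definition admissible_degrees :: "fe_family \<Rightarrow> nat \<Rightarrow> nat \<Rightarrow> bool" where
  "admissible_degrees fam k kh \<longleftrightarrow>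
     (fam = RT \<and> kh = k) \<or> (fam = BDM \<and> k \<ge> 1 \<and> kh = k - 1)"


section \<open>The data of the problem\<close>

text \<open>The two sides are indexed by the natural numbers \<open>1\<close> and \<open>2\<close>, and a pair \<open>(v\<^sub>1, v\<^sub>2)\<close> of
  functions is a function \<open>v\<close> of the side index.  The stabilisation parameters take the side and the
  order \<open>j\<close> of the derivative as arguments.  \<open>mesh h\<close> is the mesh with mesh size \<open>h\<close>.\<close>

record ('n::finite) darcy =
  region :: "(real ^ 'n) set"
  sub :: "nat \<Rightarrow> (real ^ 'n) set"
  gam :: "(real ^ 'n) set"
  bdry_p :: "(real ^ 'n) set"
  bdry_u :: "(real ^ 'n) set"
  src_f :: "real ^ 'n \<Rightarrow> real ^ 'n"
  src_g :: "real ^ 'n \<Rightarrow> real"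
  p_B :: "real ^ 'n \<Rightarrow> real"
  p_hat :: "real ^ 'n \<Rightarrow> real"
  xi :: real
  perm :: "real ^ 'n \<Rightarrow> real ^ 'n ^ 'n"
  eta_gam :: "real ^ 'n \<Rightarrow> real"
  tau_u :: "nat \<Rightarrow> nat \<Rightarrow> real"
  tau_b :: "nat \<Rightarrow> nat \<Rightarrow> real"
  mesh :: "real \<Rightarrow> (real ^ 'n) set set"

text \<open>The outward unit normal of \<open>U\<close> at a boundary point at which \<open>frontier U\<close> is a \<open>C\<^sup>1\<close> hypersurface
  with \<open>U\<close> on one side: \<open>n\<close> is orthogonal to the tangent space and points out of \<open>U\<close>.  It does not
  exist at the corners and edges of a polytope, which form a null set for \<open>surf\<close>.\<close>

definition is_outer_normal :: "(real ^ 'n) set \<Rightarrow> real ^ 'n \<Rightarrow> real ^ 'n \<Rightarrow> bool" where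
  "is_outer_normal U x n \<longleftrightarrow> norm n = 1 \<and>
     ((\<lambda>y. n \<bullet> (y - x) / norm (y - x)) \<longlongrightarrow> 0) (at x within frontier U) \<and>
     (\<exists>e>0. \<forall>t. 0 < t \<and> t < e \<longrightarrow> x - t *\<^sub>R n \<in> U \<and> x + t *\<^sub>R n \<notin> closure U)"

definition outer_normal :: "(real ^ 'n) set \<Rightarrow> real ^ 'n \<Rightarrow> real ^ 'n" where
  "outer_normal U x = (SOME n. is_outer_normal U x n)"

text \<open>\<open>gam\<close> is relatively closed in the open set \<open>region\<close>; it may be a closed surface inside \<open>region\<close> or
  reach the boundary of \<open>region\<close>, and it is smooth up to the boundary.\<close>

definition smooth_interface :: "(real ^ 'n) set \<Rightarrow> (real ^ 'n) set \<Rightarrow> bool" where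
  "smooth_interface Om G \<longleftrightarrow> (\<forall>x\<in>closure G. \<exists>U \<psi>. x \<in> U \<and> smooth_on U \<psi> \<and>
     (\<forall>y\<in>U. grad \<psi> y \<noteq> 0) \<and> G \<inter> U = {y \<in> U \<inter> Om. \<psi> y = 0})"

definition geometry :: "('n::finite) darcy \<Rightarrow> bool" where
  "geometry D \<longleftrightarrow> CARD('n) \<in> {2, 3} \<and>
     open (region D) \<and> bounded (region D) \<and> convex (region D) \<and> polytope (closure (region D)) \<and>
     (\<forall>i\<in>{1, 2}. open (sub D i) \<and> connected (sub D i) \<and> sub D i \<noteq> {}) \<and>
     sub D 1 \<inter> sub D 2 = {} \<and>
     region D = sub D 1 \<union> gam D \<union> sub D 2 \<and>
     (\<forall>i\<in>{1, 2}. gam D = region D \<inter> frontier (sub D i)) \<and>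
     smooth_interface (region D) (gam D) \<and>
     frontier (region D) = bdry_p D \<union> bdry_u D \<and> bdry_p D \<inter> bdry_u D = {} \<and>
     bdry_p D \<in> sets borel"

definition data_ok :: "('n::finite) darcy \<Rightarrow> bool" where
  "data_ok D \<longleftrightarrow>
     (\<forall>i\<in>{1, 2}. L2_on lebesgue (sub D i) (src_f D) \<and> L2_on lebesgue (sub D i) (src_g D)) \<and>
     H_half (bdry_p D) (p_B D) \<and> H_half (gam D) (p_hat D) \<and>
     0 < xi D \<and> xi D \<le> 1 / 4 \<and>
     (\<forall>i\<in>{1, 2}. set_borel_measurable lebesgue (sub D i) (perm D)) \<and>
     (\<forall>x\<in>sub D 1 \<union> sub D 2. \<forall>i j. i \<noteq> j \<longrightarrow> perm D x $ i $ j = 0) \<and>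
     (\<exists>\<kappa>>0. \<forall>x\<in>sub D 1 \<union> sub D 2. \<forall>i. \<kappa> \<le> perm D x $ i $ i) \<and>
     set_borel_measurable surf (gam D) (eta_gam D) \<and> (\<forall>x\<in>gam D. 0 \<le> eta_gam D x) \<and>
     (\<forall>i\<in>{1, 2}. \<forall>j. 0 < tau_u D i j \<and> 0 < tau_b D i j)"


section \<open>Meshes\<close>

text \<open>In two dimensions a cut element is entered and left exactly once; in three dimensions the
  interface meets the boundary of a cut element in a curve, and only the condition on the open
  edges is meaningful.  The closure of \<open>gam\<close> takes care of elements where \<open>gam\<close> ends on the boundary
  of \<open>region\<close>.\<close>

definition cut_ok :: "(real ^ 'n) set \<Rightarrow> (real ^ 'n) set \<Rightarrow> bool" where
  "cut_ok G T \<longleftrightarrow> (CARD('n) = 2 \<longrightarrow> card (closure G \<inter> frontier T) = 2) \<and>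
     (\<forall>E. E face_of T \<and> aff_dim E = 1 \<longrightarrow>
        (\<forall>x\<in>closure G \<inter> rel_interior E. \<forall>y\<in>closure G \<inter> rel_interior E. x = y))"

text \<open>A quasi-uniform family of conforming simplicial meshes, indexed by a set \<open>H\<close> of mesh sizes.\<close>

definition mesh_family :: "('n::finite) darcy \<Rightarrow> real \<Rightarrow> real set \<Rightarrow> bool" where
  "mesh_family D h0 H \<longleftrightarrow> 0 < h0 \<and> h0 < 1 \<and> H \<subseteq> {0<..h0} \<and>
     (\<forall>h\<in>H. triangulation (mesh D h) \<and> (\<forall>T\<in>mesh D h. int CARD('n) simplex T) \<and>
        \<Union>(mesh D h) = closure (region D) \<and> h = Max (diameter ` mesh D h) \<and>
        (\<forall>T\<in>mesh D h. gam D \<inter> interior T \<noteq> {} \<longrightarrow> cut_ok (gam D) T)) \<and>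
     (\<exists>c>0. \<forall>h\<in>H. \<forall>T\<in>mesh D h. c * h \<le> diameter T \<and> (\<exists>x. cball x (c * diameter T) \<subseteq> T))"

definition cut_elems :: "('n::finite) darcy \<Rightarrow> real \<Rightarrow> (real ^ 'n) set set" where
  "cut_elems D h = {T \<in> mesh D h. emeasure surf (gam D \<inter> T) > 0}"

definition cut_faces :: "('n::finite) darcy \<Rightarrow> real \<Rightarrow> (real ^ 'n) set set" where
  "cut_faces D h = {F. \<exists>T\<in>cut_elems D h. F facet_of T}"

definition act_mesh :: "('n::finite) darcy \<Rightarrow> real \<Rightarrow> nat \<Rightarrow> (real ^ 'n) set set" where
  "act_mesh D h i = {T \<in> mesh D h. T \<inter> sub D i \<noteq> {}}"

definition act_dom :: "('n::finite) darcy \<Rightarrow> real \<Rightarrow> nat \<Rightarrow> (real ^ 'n) set" where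
  "act_dom D h i = \<Union>(act_mesh D h i)"

definition share_face :: "('n::finite) darcy \<Rightarrow> real \<Rightarrow> nat \<Rightarrow> (real ^ 'n) set \<Rightarrow>
    (real ^ 'n) set \<times> (real ^ 'n) set \<Rightarrow> bool" where
  "share_face D h i F = (\<lambda>(T, T'). T \<in> act_mesh D h i \<and> T' \<in> act_mesh D h i \<and> T \<noteq> T' \<and>
     F facet_of T \<and> F facet_of T')"

definition stab_faces :: "('n::finite) darcy \<Rightarrow> real \<Rightarrow> nat \<Rightarrow> (real ^ 'n) set set" where
  "stab_faces D h i = {F \<in> cut_faces D h. \<exists>P. share_face D h i F P}"


section \<open>Traces and jumps\<close>

text \<open>Discrete functions are determined by their values in the interiors of the elements; on faces
  they are two-valued.  Hence all values on lower-dimensional sets are limits from the interiors.\<close>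

definition elem_trace :: "(real ^ 'n) set \<Rightarrow> (real ^ 'n \<Rightarrow> 'b::t2_space) \<Rightarrow> real ^ 'n \<Rightarrow> 'b" where
  "elem_trace T f x = Lim (at x within interior T) f"

definition side_trace ::
    "('n::finite) darcy \<Rightarrow> real \<Rightarrow> nat \<Rightarrow> (real ^ 'n \<Rightarrow> 'b::t2_space) \<Rightarrow> real ^ 'n \<Rightarrow> 'b" where
  "side_trace D h i f x = Lim (at x within sub D i \<inter> (\<Union>T\<in>mesh D h. interior T)) f"

text \<open>The choice of the order of the two elements and of the sign of the normal is immaterial:
  jumps, and normal derivatives of a given order, only occur in products of two.\<close>

definition face_jump :: "('n::finite) darcy \<Rightarrow> real \<Rightarrow> nat \<Rightarrow> (real ^ 'n) set \<Rightarrow>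
    (real ^ 'n \<Rightarrow> 'b::real_normed_vector) \<Rightarrow> real ^ 'n \<Rightarrow> 'b" where
  "face_jump D h i F f x =
     (case SOME P. share_face D h i F P of (T, T') \<Rightarrow> elem_trace T f x - elem_trace T' f x)"

definition face_normal :: "(real ^ 'n) set \<Rightarrow> real ^ 'n" where
  "face_normal F = (SOME n. norm n = 1 \<and> (\<forall>x\<in>F. \<forall>y\<in>F. n \<bullet> (x - y) = 0))"

definition gam_normal_comp ::
    "('n::finite) darcy \<Rightarrow> real \<Rightarrow> nat \<Rightarrow> (nat \<Rightarrow> real ^ 'n \<Rightarrow> real ^ 'n) \<Rightarrow> real ^ 'n \<Rightarrow> real" where
  "gam_normal_comp D h i v x = side_trace D h i (v i) x \<bullet> outer_normal (sub D 1) x"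

definition gam_jump ::
    "('n::finite) darcy \<Rightarrow> real \<Rightarrow> (nat \<Rightarrow> real ^ 'n \<Rightarrow> real ^ 'n) \<Rightarrow> real ^ 'n \<Rightarrow> real" where
  "gam_jump D h v x = gam_normal_comp D h 1 v x - gam_normal_comp D h 2 v x"

definition gam_avg ::
    "('n::finite) darcy \<Rightarrow> real \<Rightarrow> (nat \<Rightarrow> real ^ 'n \<Rightarrow> real ^ 'n) \<Rightarrow> real ^ 'n \<Rightarrow> real" where
  "gam_avg D h v x = (gam_normal_comp D h 1 v x + gam_normal_comp D h 2 v x) / 2"


section \<open>Discrete spaces\<close>

definition V_act :: "('n::finite) darcy \<Rightarrow> real \<Rightarrow> fe_family \<Rightarrow> nat \<Rightarrow> nat \<Rightarrow>
    (real ^ 'n \<Rightarrow> real ^ 'n) set" where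
  "V_act D h fam k i = {v. Hdiv (interior (act_dom D h i)) v \<and>
     (\<forall>T\<in>act_mesh D h i. \<exists>p\<in>V_loc fam k. \<forall>x\<in>interior T. v x = p x) \<and>
     (\<forall>T\<in>act_mesh D h i. AE x in surf. x \<in> bdry_u D \<inter> T \<longrightarrow>
        elem_trace T v x \<bullet> outer_normal (region D) x = 0)}"

definition Q_act :: "('n::finite) darcy \<Rightarrow> real \<Rightarrow> nat \<Rightarrow> nat \<Rightarrow> (real ^ 'n \<Rightarrow> real) set" where
  "Q_act D h kh i = {q. \<forall>T\<in>act_mesh D h i. \<exists>p\<in>P_deg kh. \<forall>x\<in>interior T. q x = p x}"

definition V_h :: "('n::finite) darcy \<Rightarrow> real \<Rightarrow> fe_family \<Rightarrow> nat \<Rightarrow>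
    (nat \<Rightarrow> real ^ 'n \<Rightarrow> real ^ 'n) set" where
  "V_h D h fam k = {v. \<forall>i\<in>{1, 2}. v i \<in> V_act D h fam k i}"

definition Q_h :: "('n::finite) darcy \<Rightarrow> real \<Rightarrow> nat \<Rightarrow> (nat \<Rightarrow> real ^ 'n \<Rightarrow> real) set" where
  "Q_h D h kh = {q. (\<forall>i\<in>{1, 2}. q i \<in> Q_act D h kh i) \<and>
     (bdry_p D = {} \<longrightarrow> (\<Sum>i\<in>{1, 2}. LINT x:sub D i|lebesgue. q i x) = 0)}"


section \<open>Forms\<close>

text \<open>The argument \<open>h\<close> of the forms is the global mesh size, which is the maximal element diameter.\<close>

definition form_su :: "('n::finite) darcy \<Rightarrow> real \<Rightarrow> nat \<Rightarrow>
    (nat \<Rightarrow> real ^ 'n \<Rightarrow> real ^ 'n) \<Rightarrow> (nat \<Rightarrow> real ^ 'n \<Rightarrow> real ^ 'n) \<Rightarrow> real" where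
  "form_su D h kh u v = (\<Sum>i\<in>{1, 2}. \<Sum>F\<in>stab_faces D h i. \<Sum>j\<le>kh + 1.
     tau_u D i j * h ^ (2 * j + 1) *
     (LINT x:F|surf. face_jump D h i F ((dir_deriv (face_normal F) ^^ j) (u i)) x \<bullet>
                     face_jump D h i F ((dir_deriv (face_normal F) ^^ j) (v i)) x))"

text \<open>The inner product of the derivative tensors of order \<open>j\<close> is the sum over all index tuples of
  length \<open>j\<close>.\<close>

definition form_sb :: "('n::finite) darcy \<Rightarrow> real \<Rightarrow> nat \<Rightarrow>
    (nat \<Rightarrow> real ^ 'n \<Rightarrow> real ^ 'n) \<Rightarrow> (nat \<Rightarrow> real ^ 'n \<Rightarrow> real) \<Rightarrow> real" where
  "form_sb D h kh u q = (\<Sum>i\<in>{1, 2}. \<Sum>F\<in>stab_faces D h i. \<Sum>j\<le>kh.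
     tau_b D i j * h ^ (2 * j + 1) *
     (LINT x:F|surf. \<Sum>is | length is = j.
        face_jump D h i F (partials is (dvg (u i))) x * face_jump D h i F (partials is (q i)) x))"

definition form_A :: "('n::finite) darcy \<Rightarrow> real \<Rightarrow> nat \<Rightarrow>
    (nat \<Rightarrow> real ^ 'n \<Rightarrow> real ^ 'n) \<Rightarrow> (nat \<Rightarrow> real ^ 'n \<Rightarrow> real ^ 'n) \<Rightarrow> real" where
  "form_A D h kh u v =
     (\<Sum>i\<in>{1, 2}. LINT x:sub D i|lebesgue. (matrix_inv (perm D x) *v u i x) \<bullet> v i x) +
     (LINT x:gam D|surf. eta_gam D x * gam_avg D h u x * gam_avg D h v x) +
     (LINT x:gam D|surf. xi D * eta_gam D x * gam_jump D h u x * gam_jump D h v x) +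
     form_su D h kh u v"

definition form_B :: "('n::finite) darcy \<Rightarrow> real \<Rightarrow> nat \<Rightarrow>
    (nat \<Rightarrow> real ^ 'n \<Rightarrow> real ^ 'n) \<Rightarrow> (nat \<Rightarrow> real ^ 'n \<Rightarrow> real) \<Rightarrow> real" where
  "form_B D h kh u q =
     - (\<Sum>i\<in>{1, 2}. LINT x:sub D i|lebesgue. dvg (u i) x * q i x) - form_sb D h kh u q"

definition form_F :: "('n::finite) darcy \<Rightarrow> real \<Rightarrow> (nat \<Rightarrow> real ^ 'n \<Rightarrow> real ^ 'n) \<Rightarrow> real" where
  "form_F D h v =
     (\<Sum>i\<in>{1, 2}. LINT x:sub D i|lebesgue. src_f D x \<bullet> v i x) -
     (\<Sum>i\<in>{1, 2}. LINT x:bdry_p D \<inter> frontier (sub D i)|surf.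
        p_B D x * (side_trace D h i (v i) x \<bullet> outer_normal (region D) x)) -
     (LINT x:gam D|surf. p_hat D x * gam_jump D h v x)"

definition form_G :: "('n::finite) darcy \<Rightarrow> (nat \<Rightarrow> real ^ 'n \<Rightarrow> real) \<Rightarrow> real" where
  "form_G D q = - (\<Sum>i\<in>{1, 2}. LINT x:sub D i|lebesgue. src_g D x * q i x)"

definition discrete_solution :: "('n::finite) darcy \<Rightarrow> real \<Rightarrow> fe_family \<Rightarrow> nat \<Rightarrow> nat \<Rightarrow>
    (nat \<Rightarrow> real ^ 'n \<Rightarrow> real ^ 'n) \<Rightarrow> (nat \<Rightarrow> real ^ 'n \<Rightarrow> real) \<Rightarrow> bool" where
  "discrete_solution D h fam k kh u p \<longleftrightarrow> u \<in> V_h D h fam k \<and> p \<in> Q_h D h kh \<and>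
     (\<forall>v\<in>V_h D h fam k. form_A D h kh u v + form_B D h kh v p = form_F D h v) \<and>
     (\<forall>q\<in>Q_h D h kh. form_B D h kh u q = form_G D q)"

end

theory Submission
  imports Defs
begin

text \<open>Test the second equation with \<open>q = dvg u_h\<close>.  This is an admissible discrete pressure: the
  divergence maps the local space of either family into the polynomials of degree \<open>kh\<close>
  (\<open>V_loc_dvg\<close>), and if the pressure space is constrained, the equation for the constant \<open>1\<close> says that
  the divergence has mean zero, since constants have no jumps (\<open>form_sb_const\<close>).  As the right-hand side
  vanishes, the sum of the squared \<open>L\<^sup>2\<close>-norms of the divergences over \<open>sub D i\<close> plus the
  stabilisation term \<open>form_sb\<close> is zero.  With this test function the stabilisation is a sum of squares of
  jumps (\<open>form_sb_dvg_nonneg\<close>), so each divergence vanishes almost everywhere on \<open>sub D i\<close>.  Every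
  active element meets the open set \<open>sub D i\<close> in a set with nonempty interior, and a polynomial that
  vanishes almost everywhere on a nonempty open set is zero
  (\<open>real_polynomial_function_zero_if_AE_zero\<close>).  Thus the divergence vanishes on the whole element, also
  on the part outside \<open>sub D i\<close>.

  For the weak divergence on the active domain, membership in \<open>Hdiv\<close> provides a square integrable
  weak divergence \<open>w\<close>, and the faces, being null sets, do not contribute to the integral of \<open>w \<phi>\<close>.
  On a single element that integral vanishes (\<open>weak_div_integral_cell_eq_0\<close>): multiplied by a cutoff
  supported in the interior of the element (\<open>polyhedron_cutoffs\<close>), \<open>\<phi>\<close> tests \<open>w\<close> only where the field
  is a solenoidal polynomial, and there integration by parts
  (\<open>integral_solenoidal_inner_grad_eq_0\<close>) gives zero; as the cutoffs tend to \<open>1\<close> in the interior, dominated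
  convergence removes them.\<close>

section \<open>Polynomials and their divergence\<close>

abbreviation multi_indices :: "nat \<Rightarrow> ('n::finite \<Rightarrow> nat) set" where
  "multi_indices k \<equiv> {\<alpha>. (\<Sum>i\<in>UNIV. \<alpha> i) \<le> k}"

abbreviation monomial :: "('n::finite \<Rightarrow> nat) \<Rightarrow> real ^ 'n \<Rightarrow> real" where
  "monomial \<alpha> x \<equiv> \<Prod>i\<in>UNIV. (x $ i) ^ \<alpha> i"

lemma finite_multi_indices: "finite (multi_indices k :: ('n::finite \<Rightarrow> nat) set)"
proof (rule finite_subset)
  have "\<alpha> i \<le> k" if "\<alpha> \<in> multi_indices k" for \<alpha> :: "'n \<Rightarrow> nat" and i
    using that member_le_sum[of i UNIV \<alpha>] by simp
  then show "multi_indices k \<subseteq> (UNIV::'n set) \<rightarrow>\<^sub>E {..k}"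
    by (simp add: PiE_UNIV_domain Pi_def subset_iff)
qed (auto intro: finite_PiE)

lemma P_deg_add:
  assumes "p \<in> P_deg k" "q \<in> P_deg k" shows "(\<lambda>x. p x + q x) \<in> P_deg k"
proof -
  from assms obtain c d where "\<forall>x. p x = (\<Sum>\<alpha>\<in>multi_indices k. c \<alpha> * monomial \<alpha> x)"
    "\<forall>x. q x = (\<Sum>\<alpha>\<in>multi_indices k. d \<alpha> * monomial \<alpha> x)"
    by (auto simp: P_deg_def)
  then show ?thesis
    by (auto simp: P_deg_def sum.distrib ring_distribs intro!: exI[of _ "\<lambda>\<alpha>. c \<alpha> + d \<alpha>"])
qed

lemma P_deg_cmult:
  assumes "p \<in> P_deg k" shows "(\<lambda>x. a * p x) \<in> P_deg k"
proof -
  from assms obtain c where "\<forall>x. p x = (\<Sum>\<alpha>\<in>multi_indices k. c \<alpha> * monomial \<alpha> x)"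
    by (auto simp: P_deg_def)
  then show ?thesis
    by (auto simp: P_deg_def sum_distrib_left mult.assoc intro!: exI[of _ "\<lambda>\<alpha>. a * c \<alpha>"])
qed

lemma P_deg_zero: "(\<lambda>x. 0) \<in> P_deg k"
  by (auto simp: P_deg_def intro: exI[of _ "\<lambda>\<alpha>. 0"])

lemma P_deg_sum:
  assumes "\<And>i. i \<in> I \<Longrightarrow> p i \<in> P_deg k" shows "(\<lambda>x. \<Sum>i\<in>I. p i x) \<in> P_deg k"
  using assms by (induction I rule: infinite_finite_induct) (auto intro: P_deg_add P_deg_zero)

lemma P_deg_monomial:
  assumes "(\<Sum>i\<in>UNIV. \<alpha> i) \<le> k" shows "monomial \<alpha> \<in> P_deg k"
proof -
  have "monomial \<alpha> x = (\<Sum>\<beta>\<in>multi_indices k. (if \<beta> = \<alpha> then 1 else 0) * monomial \<beta> x)" for x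
    using assms by (simp add: if_distrib[of "\<lambda>z. z * _"] sum.delta' finite_multi_indices cong: if_cong)
  then show ?thesis
    unfolding P_deg_def by (auto intro!: exI[of _ "\<lambda>\<beta>. if \<beta> = \<alpha> then 1 else 0"])
qed

lemma P_deg_eq_sum_monomials:
  assumes "p \<in> P_deg k"
  obtains c where "p = (\<lambda>x. \<Sum>\<alpha>\<in>multi_indices k. c \<alpha> * monomial \<alpha> x)"
  using assms by (auto simp: P_deg_def)

lemma real_polynomial_function_nth: "real_polynomial_function (\<lambda>x::real^'n. x $ i)"
  by (intro real_polynomial_function.intros) (rule bounded_linear_vec_nth)

lemma P_deg_real_polynomial_function:
  assumes "p \<in> P_deg k" shows "real_polynomial_function p"
proof -
  obtain c where p: "p = (\<lambda>x. \<Sum>\<alpha>\<in>multi_indices k. c \<alpha> * monomial \<alpha> x)"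
    using P_deg_eq_sum_monomials[OF assms] .
  show ?thesis unfolding p
    by (intro real_polynomial_function_sum real_polynomial_function.intros(2,4)
        real_polynomial_function_prod real_polynomial_function_power
        real_polynomial_function_nth finite finite_multi_indices)
qed

lemma P_deg_differentiable: "p \<in> P_deg k \<Longrightarrow> p differentiable at x"
  using P_deg_real_polynomial_function differentiable_at_real_polynomial_function by blast

lemma P_deg_continuous: "p \<in> P_deg k \<Longrightarrow> continuous_on S p"
  using P_deg_real_polynomial_function continuous_on_polymonial_function
    real_polynomial_function_eq by blast

lemma partial_has_derivative:
  "(f has_derivative f') (at x) \<Longrightarrow> partial i f x = f' (axis i 1)"
  by (metis dir_deriv_def frechet_derivative_at)

lemma partial_cmult:
  fixes f :: "real^'n \<Rightarrow> real"
  assumes "f differentiable at x" shows "partial i (\<lambda>y. c * f y) x = c * partial i f x"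
proof -
  from assms obtain f' where f: "(f has_derivative f') (at x)" by (auto simp: differentiable_def)
  from f show ?thesis
    using partial_has_derivative[OF f] partial_has_derivative[OF has_derivative_mult_right[OF f]] by simp
qed

lemma partial_mult:
  fixes f g :: "real^'n \<Rightarrow> real"
  assumes "f differentiable at x" "g differentiable at x"
  shows "partial i (\<lambda>y. f y * g y) x = f x * partial i g x + partial i f x * g x"
proof -
  from assms obtain f' g' where fg: "(f has_derivative f') (at x)" "(g has_derivative g') (at x)"
    by (auto simp: differentiable_def)
  show ?thesis
    using partial_has_derivative[OF fg(1)] partial_has_derivative[OF fg(2)]
      partial_has_derivative[OF has_derivative_mult[OF fg]] by simp
qed

lemma partial_add:
  fixes f g :: "real^'n \<Rightarrow> real"
  assumes "f differentiable at x" "g differentiable at x"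
  shows "partial i (\<lambda>y. f y + g y) x = partial i f x + partial i g x"
proof -
  from assms obtain f' g' where fg: "(f has_derivative f') (at x)" "(g has_derivative g') (at x)"
    by (auto simp: differentiable_def)
  show ?thesis
    using partial_has_derivative[OF fg(1)] partial_has_derivative[OF fg(2)]
      partial_has_derivative[OF has_derivative_add[OF fg]] by simp
qed

lemma partial_sum:
  fixes f :: "'a \<Rightarrow> real^'n \<Rightarrow> real"
  assumes "\<And>j. j \<in> J \<Longrightarrow> f j differentiable at x"
  shows "partial i (\<lambda>y. \<Sum>j\<in>J. f j y) x = (\<Sum>j\<in>J. partial i (f j) x)"
proof -
  from assms have "\<forall>j\<in>J. \<exists>f'. (f j has_derivative f') (at x)" by (auto simp: differentiable_def)
  then obtain f' where f': "\<And>j. j \<in> J \<Longrightarrow> (f j has_derivative f' j) (at x)" by metis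
  show ?thesis
    using partial_has_derivative[OF has_derivative_sum[OF f']] partial_has_derivative[OF f'] by simp
qed

lemma partial_nth: "partial i (\<lambda>y::real^'n. y $ j) x = (if i = j then 1 else 0)"
  by (subst partial_has_derivative[of _ "\<lambda>h. h $ j"])
     (auto simp: axis_def intro!: bounded_linear_imp_has_derivative bounded_linear_vec_nth)

lemma monomial_differentiable: "monomial \<alpha> differentiable at x"
  by (rule P_deg_differentiable[OF P_deg_monomial[OF order_refl]])

lemma partial_monomial:
  fixes \<alpha> :: "'n::finite \<Rightarrow> nat"
  shows "partial i (monomial \<alpha>) x = real (\<alpha> i) * monomial (\<alpha>(i := \<alpha> i - 1)) x"
proof -
  let ?D = "\<lambda>h::real^'n. \<Sum>j\<in>UNIV. (real (\<alpha> j) * h $ j * (x $ j) ^ (\<alpha> j - 1)) * (\<Prod>l\<in>UNIV - {j}. (x $ l) ^ \<alpha> l)"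
  have D: "(monomial \<alpha> has_derivative ?D) (at x)"
    by (rule has_derivative_prod)
       (auto intro!: derivative_eq_intros bounded_linear_imp_has_derivative bounded_linear_vec_nth)
  have "partial i (monomial \<alpha>) x = ?D (axis i 1)"
    by (rule partial_has_derivative[OF D])
  also have "\<dots> = (\<Sum>j\<in>UNIV. if j = i then real (\<alpha> i) * (x $ i) ^ (\<alpha> i - 1) * (\<Prod>l\<in>UNIV - {i}. (x $ l) ^ \<alpha> l) else 0)"
    by (rule sum.cong) (auto simp: axis_def)
  also have "\<dots> = real (\<alpha> i) * ((x $ i) ^ (\<alpha> i - 1) * (\<Prod>l\<in>UNIV - {i}. (x $ l) ^ \<alpha> l))"
    by (simp add: mult.assoc)
  also have "(x $ i) ^ (\<alpha> i - 1) * (\<Prod>l\<in>UNIV - {i}. (x $ l) ^ \<alpha> l) = monomial (\<alpha>(i := \<alpha> i - 1)) x"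
    by (subst (2) prod.remove[of _ i]) (auto intro!: prod.cong)
  finally show ?thesis .
qed

lemma sum_fun_upd_pred:
  fixes \<alpha> :: "'n::finite \<Rightarrow> nat"
  assumes "\<alpha> i > 0"
  shows "(\<Sum>j\<in>UNIV. (\<alpha>(i := \<alpha> i - 1)) j) = (\<Sum>j\<in>UNIV. \<alpha> j) - 1"
proof -
  have "(\<Sum>j\<in>UNIV. \<alpha> j) = \<alpha> i + (\<Sum>j\<in>UNIV - {i}. \<alpha> j)" by (rule sum.remove) auto
  moreover have "(\<Sum>j\<in>UNIV. (\<alpha>(i := \<alpha> i - 1)) j) = (\<alpha> i - 1) + (\<Sum>j\<in>UNIV - {i}. \<alpha> j)"
    by (subst sum.remove[of _ i]) auto
  ultimately show ?thesis using assms by simp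
qed

lemma P_deg_partial:
  fixes p :: "real^'n \<Rightarrow> real"
  assumes "p \<in> P_deg k"
  shows "partial i p \<in> P_deg (k - 1)"
proof -
  obtain c where p: "p = (\<lambda>x. \<Sum>\<alpha>\<in>multi_indices k. c \<alpha> * monomial \<alpha> x)"
    using P_deg_eq_sum_monomials[OF assms] .
  have "partial i p = (\<lambda>x. \<Sum>\<alpha>\<in>multi_indices k. c \<alpha> * (real (\<alpha> i) * monomial (\<alpha>(i := \<alpha> i - 1)) x))"
    unfolding p
    by (simp add: partial_sum partial_cmult monomial_differentiable partial_monomial
        fun_eq_iff)
  moreover have "(\<lambda>x. c \<alpha> * (real (\<alpha> i) * monomial (\<alpha>(i := \<alpha> i - 1)) x)) \<in> P_deg (k - 1)"
    if "\<alpha> \<in> multi_indices k" for \<alpha>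
  proof (cases "\<alpha> i = 0")
    case False
    with that show ?thesis
      using sum_fun_upd_pred[of \<alpha> i]
      by (intro P_deg_cmult P_deg_monomial) (simp del: fun_upd_apply)
  qed (simp add: P_deg_zero)
  ultimately show ?thesis by (simp only: P_deg_sum)
qed

lemma P_deg_mono:
  assumes "j \<le> k" "p \<in> P_deg j" shows "p \<in> P_deg k"
proof -
  obtain c where p: "p = (\<lambda>x. \<Sum>\<alpha>\<in>multi_indices j. c \<alpha> * monomial \<alpha> x)"
    using P_deg_eq_sum_monomials[OF assms(2)] .
  show ?thesis unfolding p
    using assms(1) by (intro P_deg_sum P_deg_cmult P_deg_monomial) auto
qed

text \<open>Differentiating lowers the degree in one variable and multiplying by that variable restores
  it; this is why the term \<open>b x\<close> of a Raviart--Thomas field does not raise the degree of the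
  divergence above \<open>k\<close>.\<close>

lemma P_deg_nth_mult_partial:
  fixes p :: "real^'n \<Rightarrow> real"
  assumes "p \<in> P_deg k"
  shows "(\<lambda>x. x $ i * partial i p x) \<in> P_deg k"
proof -
  obtain c where p: "p = (\<lambda>x. \<Sum>\<alpha>\<in>multi_indices k. c \<alpha> * monomial \<alpha> x)"
    using P_deg_eq_sum_monomials[OF assms] .
  have mono: "x $ i * (real (\<alpha> i) * monomial (\<alpha>(i := \<alpha> i - 1)) x) = real (\<alpha> i) * monomial \<alpha> x"
    for \<alpha> and x :: "real^'n"
  proof (cases "\<alpha> i")
    case (Suc m)
    have "x $ i * monomial (\<alpha>(i := m)) x = monomial \<alpha> x"
      by (subst (1 2) prod.remove[of _ i]) (auto simp: Suc intro!: prod.cong)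
    with Suc show ?thesis by simp
  qed simp
  have "(\<lambda>x. x $ i * partial i p x)
      = (\<lambda>x. \<Sum>\<alpha>\<in>multi_indices k. c \<alpha> * (x $ i * (real (\<alpha> i) * monomial (\<alpha>(i := \<alpha> i - 1)) x)))"
    unfolding p
    by (simp add: partial_sum partial_cmult monomial_differentiable partial_monomial
        fun_eq_iff sum_distrib_left algebra_simps)
  also have "\<dots> = (\<lambda>x. \<Sum>\<alpha>\<in>multi_indices k. c \<alpha> * (real (\<alpha> i) * monomial \<alpha> x))"
    by (simp only: mono)
  also have "\<dots> \<in> P_deg k"
    by (intro P_deg_sum P_deg_cmult P_deg_monomial) auto
  finally show ?thesis .
qed

lemma BDM_loc_dvg:
  fixes v :: "real^'n \<Rightarrow> real^'n"
  assumes "v \<in> BDM_loc k" shows "dvg v \<in> P_deg (k - 1)"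
proof -
  have "partial i (\<lambda>x. v x $ i) \<in> P_deg (k - 1)" for i
    using assms by (intro P_deg_partial[of _ k]) (simp add: BDM_loc_def)
  then show ?thesis
    using P_deg_sum[of UNIV "\<lambda>i. partial i (\<lambda>x. v x $ i)"] by (simp add: dvg_def[abs_def])
qed

lemma RT_loc_dvg:
  assumes "v \<in> RT_loc k" shows "dvg v \<in> P_deg k"
proof -
  from assms obtain a b where a: "a \<in> BDM_loc k" and b: "b \<in> P_deg k"
    and v: "v = (\<lambda>x. a x + b x *\<^sub>R x)"
    by (auto simp: RT_loc_def fun_eq_iff)
  have nth: "(\<lambda>y::real^'n. y $ i) differentiable at x" for i x
    using real_polynomial_function_nth differentiable_at_real_polynomial_function by blast
  have ai: "(\<lambda>x. a x $ i) \<in> P_deg k" for i using a by (auto simp: BDM_loc_def)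
  have "partial i (\<lambda>y. v y $ i) x
      = partial i (\<lambda>y. a y $ i) x + (b x + x $ i * partial i b x)" for i x
    by (simp add: v partial_add partial_mult nth P_deg_differentiable[OF b]
        P_deg_differentiable[OF ai] partial_nth)
  then have "dvg v = (\<lambda>x. \<Sum>i\<in>UNIV. partial i (\<lambda>y. a y $ i) x + (b x + x $ i * partial i b x))"
    by (simp add: dvg_def fun_eq_iff)
  moreover have "partial i (\<lambda>y. a y $ i) \<in> P_deg k" for i
    using P_deg_mono[OF _ P_deg_partial[OF ai]] by simp
  ultimately show ?thesis
    using P_deg_sum[of UNIV "\<lambda>i x. partial i (\<lambda>y. a y $ i) x + (b x + x $ i * partial i b x)"]
      P_deg_add[OF _ P_deg_add[OF b P_deg_nth_mult_partial[OF b]]] by auto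
qed

lemma V_loc_dvg:
  assumes "admissible_degrees fam k kh" "v \<in> V_loc fam k"
  shows "dvg v \<in> P_deg kh"
  using assms BDM_loc_dvg[of v k] RT_loc_dvg[of v k] by (cases fam) (auto simp: admissible_degrees_def)

lemma V_loc_real_polynomial_function:
  fixes v :: "real^'n \<Rightarrow> real^'n"
  assumes "v \<in> V_loc fam k"
  shows "real_polynomial_function (\<lambda>x. v x $ i)"
proof (cases fam)
  case RT
  with assms obtain a b where "a \<in> BDM_loc k" "b \<in> P_deg k" "\<forall>x. v x = a x + b x *\<^sub>R x"
    by (auto simp: RT_loc_def)
  then show ?thesis
    using P_deg_real_polynomial_function
    by (auto simp: BDM_loc_def intro!: real_polynomial_function.intros(3,4) real_polynomial_function_nth)
qed (use assms P_deg_real_polynomial_function in \<open>auto simp: BDM_loc_def\<close>)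

text \<open>On a line through a point of \<open>U\<close> the function is a polynomial in one variable with infinitely
  many zeros.\<close>

lemma real_polynomial_function_zero_if_zero_on_open:
  fixes p :: "'a::euclidean_space \<Rightarrow> real"
  assumes p: "real_polynomial_function p" and U: "open U" "a \<in> U" "\<And>x. x \<in> U \<Longrightarrow> p x = 0"
  shows "p y = 0"
proof -
  let ?l = "\<lambda>t::real. a + t *\<^sub>R (y - a)"
  have "real_polynomial_function (p \<circ> ?l)"
    by (intro real_polynomial_function_compose p polynomial_function_add polynomial_function_const)
       (auto intro!: polynomial_function_bounded_linear bounded_linear_scaleR_left)
  then obtain c n where cn: "\<And>t. p (?l t) = (\<Sum>i\<le>n. c i * t ^ i)"
    by (auto simp: real_polynomial_function_iff_sum fun_eq_iff)
  have "open (?l -` U)"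
    by (intro open_vimage U continuous_intros)
  moreover have "0 \<in> ?l -` U" using U by simp
  ultimately have "infinite (?l -` U)"
    using finite_imp_not_open by blast
  moreover have "?l -` U \<subseteq> {t. (\<Sum>i\<le>n. c i * t ^ i) = 0}"
    using U(3) cn[symmetric] by auto
  ultimately have "\<not> finite {t. (\<Sum>i\<le>n. c i * t ^ i) = 0}"
    using finite_subset by blast
  then have "\<forall>i\<le>n. c i = 0" by (simp add: polyfun_finite_roots)
  then show ?thesis using cn[of 1] by simp
qed

section \<open>Continuously differentiable functions and integration by parts\<close>

definition C1 :: "(real ^ 'n \<Rightarrow> real) \<Rightarrow> bool" where
  "C1 f \<longleftrightarrow> (\<forall>x. f differentiable at x) \<and> continuous_on UNIV (grad f)"

lemma C1_iff:
  fixes f :: "real ^ 'n \<Rightarrow> real"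
  shows "C1 f \<longleftrightarrow> (\<forall>x. f differentiable at x) \<and> (\<forall>i. continuous_on UNIV (partial i f))"
proof -
  have "continuous_on UNIV (grad f) \<longleftrightarrow> (\<forall>i. continuous_on UNIV (partial i f))"
  proof
    assume "continuous_on UNIV (grad f)"
    then have "continuous_on UNIV (\<lambda>x. grad f x $ i)" for i
      by (intro continuous_intros)
    then show "\<forall>i. continuous_on UNIV (partial i f)" by (simp add: grad_def)
  next
    assume "\<forall>i. continuous_on UNIV (partial i f)"
    then show "continuous_on UNIV (grad f)"
      unfolding grad_def[abs_def] by (intro continuous_on_vec_lambda) simp
  qed
  then show ?thesis by (simp add: C1_def)
qed

lemma C1_differentiable: "C1 f \<Longrightarrow> f differentiable at x"
  by (simp add: C1_def)

lemma C1_continuous: "C1 f \<Longrightarrow> continuous_on S f"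
  by (meson C1_differentiable continuous_at_imp_continuous_on differentiable_imp_continuous_within)

lemma C1_partial_continuous: "C1 f \<Longrightarrow> continuous_on S (partial i f)"
  by (meson C1_iff continuous_on_subset subset_UNIV)

lemma partial_const: "partial i (\<lambda>y. c) x = 0"
  by (simp add: dir_deriv_def)

lemma C1_const: "C1 (\<lambda>x. c)"
  by (simp add: C1_iff partial_const[abs_def])

lemma C1_add: assumes "C1 f" "C1 g" shows "C1 (\<lambda>x. f x + g x)"
proof -
  have "partial i (\<lambda>x. f x + g x) = (\<lambda>x. partial i f x + partial i g x)" for i
    using assms by (simp add: partial_add C1_differentiable fun_eq_iff)
  with assms show ?thesis
    by (auto simp: C1_iff intro!: continuous_intros differentiable_add)
qed

lemma C1_mult: assumes "C1 f" "C1 g" shows "C1 (\<lambda>x. f x * g x)"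
proof -
  have "partial i (\<lambda>x. f x * g x) = (\<lambda>x. f x * partial i g x + partial i f x * g x)" for i
    using assms by (simp add: partial_mult C1_differentiable fun_eq_iff)
  moreover have "continuous_on UNIV f" "continuous_on UNIV g"
    using assms by (auto intro: C1_continuous)
  ultimately show ?thesis
    using assms by (auto simp: C1_iff intro!: continuous_intros)
qed

lemma C1_prod: "(\<And>j. j \<in> J \<Longrightarrow> C1 (f j)) \<Longrightarrow> C1 (\<lambda>x. \<Prod>j\<in>J. f j x)"
  by (induction J rule: infinite_finite_induct) (auto intro: C1_mult C1_const)

lemma C1_compose_affine:
  fixes \<rho> :: "real \<Rightarrow> real"
  assumes \<rho>: "\<And>s. (\<rho> has_real_derivative \<rho>' s) (at s)" and cont: "continuous_on UNIV \<rho>'"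
    and g: "bounded_linear g"
  shows "C1 (\<lambda>x::real^'n. \<rho> (g x + b))"
proof -
  have D: "((\<lambda>x. \<rho> (g x + b)) has_derivative (\<lambda>h. \<rho>' (g x + b) * g h)) (at x)" for x
  proof -
    have "((\<lambda>x. g x + b) has_derivative g) (at x)"
      using has_derivative_add[OF bounded_linear_imp_has_derivative[OF g] has_derivative_const]
      by simp
    from has_derivative_compose[OF this \<rho>[unfolded has_field_derivative_def]]
    show ?thesis by (simp add: mult.commute)
  qed
  have "partial i (\<lambda>x. \<rho> (g x + b)) = (\<lambda>x. \<rho>' (g x + b) * g (axis i 1))" for i
    using partial_has_derivative[OF D] by (auto simp: fun_eq_iff)
  moreover have "continuous_on UNIV (\<lambda>x. \<rho>' (g x + b))"
    by (rule continuous_on_compose2[OF cont continuous_on_add[OF linear_continuous_on[OF g]]])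
       auto
  ultimately show ?thesis
    using D by (auto simp: C1_iff differentiable_def intro!: continuous_intros)
qed

lemma C1_real_polynomial_function:
  fixes p :: "real^'n \<Rightarrow> real"
  assumes "real_polynomial_function p" shows "C1 p"
  using assms
proof induction
  case (linear f)
  from C1_compose_affine[OF _ _ this, of "\<lambda>s. s" "\<lambda>s. 1" 0] show ?case by simp
qed (auto intro: C1_const C1_add C1_mult)

lemma partial_eq_0_outside_support:
  fixes f :: "real^'n \<Rightarrow> real"
  assumes "x \<notin> closure {x. f x \<noteq> 0}"
  shows "partial i f x = 0"
proof -
  have "(f has_derivative (\<lambda>h. 0)) (at x)"
  proof (rule has_derivative_transform_within_open)
    show "((\<lambda>x. 0) has_derivative (\<lambda>h. 0)) (at x)" by simp
    show "open (- closure {x. f x \<noteq> 0})" "x \<in> - closure {x. f x \<noteq> 0}" using assms by auto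
    show "0 = f y" if "y \<in> - closure {x. f x \<noteq> 0}" for y
      using that subsetD[OF closure_subset[of "{x. f x \<noteq> 0}"], of y] by auto
  qed
  from partial_has_derivative[OF this] show ?thesis .
qed

lemma grad_eq_0_outside_support:
  fixes f :: "real^'n \<Rightarrow> real"
  shows "x \<notin> closure {x. f x \<noteq> 0} \<Longrightarrow> grad f x = 0"
  by (simp add: grad_def partial_eq_0_outside_support vec_eq_iff)

lemma integrable_continuous_bounded_support:
  fixes f :: "real^'n \<Rightarrow> real"
  assumes cont: "continuous_on UNIV f" and bd: "bounded S" and zero: "\<And>x. x \<notin> S \<Longrightarrow> f x = 0"
  shows "integrable lborel f"
proof -
  obtain r where r: "S \<subseteq> cball 0 r" using bounded_subset_ballD[OF bd, of 0] ball_subset_cball by (meson order_trans)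
  have "integrable lborel (\<lambda>x. indicator (cball 0 r) x *\<^sub>R f x)"
    by (rule borel_integrable_compact) (use cont continuous_on_subset in auto)
  also have "(\<lambda>x. indicator (cball 0 r) x *\<^sub>R f x) = f"
    using r zero by (fastforce simp: indicator_def fun_eq_iff)
  finally show ?thesis .
qed

lemma lborel_integral_translate:
  fixes f :: "'a::euclidean_space \<Rightarrow> real"
  assumes "f \<in> borel_measurable borel"
  shows "(\<integral>x. f (a + x) \<partial>lborel) = (\<integral>x. f x \<partial>lborel)"
proof -
  have "(\<integral>x. f x \<partial>lborel) = (\<integral>x. f x \<partial>distr lborel borel ((+) a))"
    by (simp add: lborel_distr_plus)
  also have "\<dots> = (\<integral>x. f (a + x) \<partial>lborel)"
    using assms by (intro integral_distr) auto
  finally show ?thesis by simp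
qed

text \<open>The integral is invariant under translation, so all difference quotients of \<open>f\<close> integrate to
  zero.  They converge to the partial derivative, and the mean value theorem provides a dominating
  function.\<close>

lemma integral_partial_eq_0:
  fixes f :: "real^'n \<Rightarrow> real"
  assumes f: "C1 f" and bd: "bounded {x. f x \<noteq> 0}"
  shows "(\<integral>x. partial i f x \<partial>lborel) = 0"
proof -
  define e where "e = (axis i 1 :: real^'n)"
  define t where "t n = inverse (real (Suc n))" for n
  define g where "g n x = (f (t n *\<^sub>R e + x) - f x) / t n" for n x
  have t: "0 < t n" "t n \<le> 1" for n by (auto simp: t_def divide_simps)
  have t0: "t \<longlonglongrightarrow> 0" unfolding t_def by (rule LIMSEQ_inverse_real_of_nat)
  obtain r where r: "{x. f x \<noteq> 0} \<subseteq> cball 0 r" using bounded_subset_ballD[OF bd, of 0] ball_subset_cball by (meson order_trans)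
  have "bounded (partial i f ` cball 0 r)"
    by (intro compact_imp_bounded compact_continuous_image C1_partial_continuous f compact_cball)
  then obtain B where "0 < B" and "\<forall>y\<in>partial i f ` cball 0 r. norm y \<le> B"
    unfolding bounded_pos by blast
  then have B: "\<bar>partial i f x\<bar> \<le> B" if "x \<in> cball 0 r" for x
    using that by (metis imageI real_norm_def)
  have outside: "partial i f x = 0" if "x \<notin> cball 0 r" for x
    using that closure_minimal[OF r closed_cball] by (intro partial_eq_0_outside_support) auto
  have Bx: "\<bar>partial i f x\<bar> \<le> B" for x
    using B[of x] outside[of x] \<open>0 < B\<close> by (cases "x \<in> cball 0 r") auto
  have line: "((\<lambda>s. f (s *\<^sub>R e + x)) has_real_derivative partial i f (s *\<^sub>R e + x)) (at s)" for s x
  proof -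
    obtain f' where f': "(f has_derivative f') (at (s *\<^sub>R e + x))"
      using f by (auto simp: C1_def differentiable_def)
    interpret f': bounded_linear f' using f' by (rule has_derivative_bounded_linear)
    have "((\<lambda>s. s *\<^sub>R e + x) has_derivative (\<lambda>s. s *\<^sub>R e)) (at s)"
      by (auto intro!: derivative_eq_intros)
    from has_derivative_compose[OF this f'] show ?thesis
      using partial_has_derivative[OF f']
      by (simp add: has_field_derivative_def e_def f'.scaleR mult.commute[of _ "f' (axis i 1)"])
  qed
  have conv: "(\<lambda>n. g n x) \<longlonglongrightarrow> partial i f x" for x
  proof -
    have "((\<lambda>h. (f (h *\<^sub>R e + x) - f x) / h) \<longlongrightarrow> partial i f x) (at 0)"
      using line[of x 0] by (simp add: DERIV_def)
    moreover have "filterlim t (at 0) sequentially"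
      using t0 t by (auto simp: filterlim_at less_imp_neq[symmetric])
    ultimately show ?thesis unfolding g_def by (rule filterlim_compose)
  qed
  have bound: "norm (g n x) \<le> B * indicator (cball 0 (r + 1)) x" for n x
  proof (cases "x \<in> cball 0 (r + 1)")
    case True
    obtain z where "f (t n *\<^sub>R e + x) - f (0 *\<^sub>R e + x) = (t n - 0) * partial i f (z *\<^sub>R e + x)"
      using MVT2[OF t(1)[of n], of "\<lambda>s. f (s *\<^sub>R e + x)" "\<lambda>s. partial i f (s *\<^sub>R e + x)"] line by blast
    then have "g n x = partial i f (z *\<^sub>R e + x)"
      using t(1)[of n] by (simp add: g_def)
    with Bx True show ?thesis by simp
  next
    case False
    have "norm x \<le> norm (t n *\<^sub>R e + x) + norm (t n *\<^sub>R e)"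
      by (metis add_diff_cancel_left' norm_triangle_ineq4 add.commute)
    also have "norm (t n *\<^sub>R e) \<le> 1" using t[of n] by (simp add: e_def)
    finally have "x \<notin> cball 0 r" "t n *\<^sub>R e + x \<notin> cball 0 r"
      using False by auto
    then have "f x = 0" "f (t n *\<^sub>R e + x) = 0" using r by blast+
    with False show ?thesis by (simp add: g_def)
  qed
  have cf: "continuous_on UNIV f" by (rule C1_continuous[OF f])
  then have fm[measurable]: "f \<in> borel_measurable borel" by (rule borel_measurable_continuous_onI)
  have fi: "integrable lborel f"
    by (rule integrable_continuous_bounded_support[OF cf bd]) simp
  have ti: "integrable lborel (\<lambda>x. f (a + x))" for a
  proof -
    have "integrable (distr lborel borel ((+) a)) f" using fi by (simp add: lborel_distr_plus)
    then show ?thesis by (simp add: integrable_distr_eq)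
  qed
  have "(\<integral>x. g n x \<partial>lborel) = 0" for n
    unfolding g_def using fi ti lborel_integral_translate[OF fm] by simp
  moreover have "(\<lambda>n. \<integral>x. g n x \<partial>lborel) \<longlonglongrightarrow> (\<integral>x. partial i f x \<partial>lborel)"
  proof (rule integral_dominated_convergence)
    show "partial i f \<in> borel_measurable lborel"
      using borel_measurable_continuous_onI[OF C1_partial_continuous[OF f]] by simp
    show "integrable lborel (\<lambda>x. B * indicator (cball 0 (r + 1)) x)"
      by (intro integrable_mult_right integrable_real_indicator)
         (simp_all only: emeasure_lborel_cball_finite sets_lborel borel_closed closed_cball)
  qed (use conv bound in \<open>auto simp: g_def\<close>)
  ultimately show ?thesis by (simp add: LIMSEQ_const_iff)
qed

text \<open>The product \<open>\<psi> dvg v\<close> vanishes everywhere, so \<open>v \<bullet> grad \<psi>\<close> is the divergence of the compactly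
  supported field \<open>\<psi> v\<close>, and each of its terms integrates to zero.\<close>

lemma integral_solenoidal_inner_grad_eq_0:
  fixes \<psi> :: "real^'n \<Rightarrow> real" and v :: "real^'n \<Rightarrow> real^'n"
  assumes \<psi>: "C1 \<psi>" and bd: "bounded {x. \<psi> x \<noteq> 0}" and v: "\<And>i. C1 (\<lambda>x. v x $ i)"
    and div: "\<And>x. \<psi> x \<noteq> 0 \<Longrightarrow> dvg v x = 0"
  shows "(\<integral>x. v x \<bullet> grad \<psi> x \<partial>lebesgue) = 0"
proof -
  let ?F = "\<lambda>i x. \<psi> x * v x $ i"
  have F: "C1 (?F i)" for i by (intro C1_mult \<psi> v)
  have bF: "bounded {x. ?F i x \<noteq> 0}" for i
    by (rule bounded_subset[OF bd]) auto
  have "v x \<bullet> grad \<psi> x = (\<Sum>i\<in>UNIV. partial i (?F i) x)" for x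
  proof -
    have "(\<Sum>i\<in>UNIV. partial i (?F i) x) = \<psi> x * dvg v x + (\<Sum>i\<in>UNIV. partial i \<psi> x * v x $ i)"
      by (simp add: partial_mult C1_differentiable \<psi> v sum.distrib dvg_def sum_distrib_left)
    also have "\<psi> x * dvg v x = 0" using div by auto
    finally show ?thesis by (simp add: inner_vec_def grad_def mult.commute)
  qed
  moreover have int: "integrable lborel (partial i (?F i))" for i
    by (rule integrable_continuous_bounded_support[OF C1_partial_continuous[OF F]
          bounded_closure[OF bF[of i]]])
       (rule partial_eq_0_outside_support)
  moreover have "partial i (?F i) \<in> borel_measurable lborel" for i
    using int by auto
  ultimately show ?thesis
    by (simp add: integral_completion integral_partial_eq_0[OF F bF])
qed

section \<open>Cutoff functions on polyhedra\<close>

text \<open>The ramp stays zero up to \<open>1\<close> instead of \<open>0\<close>, so that rescaling its argument by \<open>n\<close> leaves a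
  gap of width \<open>1 / n\<close> between the origin and the support; this keeps the closed supports of the
  cutoffs below inside the open polyhedron.\<close>

definition ramp :: "real \<Rightarrow> real" where
  "ramp s = (max 0 (s - 1))\<^sup>2 / (1 + (max 0 (s - 1))\<^sup>2)"

lemma ramp_nonneg: "0 \<le> ramp s" and ramp_le_1: "ramp s \<le> 1"
  by (auto simp: ramp_def divide_simps add_nonneg_eq_0_iff add_pos_nonneg)

lemma ramp_eq_0: "s \<le> 1 \<Longrightarrow> ramp s = 0"
  by (simp add: ramp_def)

lemma ramp_tendsto_1: "(ramp \<longlongrightarrow> 1) at_top"
proof -
  have "filterlim (\<lambda>s::real. 1 + (s - 1)\<^sup>2) at_top at_top"
  proof (rule filterlim_at_top_mono)
    show "filterlim (\<lambda>s::real. - 1 + s) at_top at_top"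
      by (rule filterlim_tendsto_add_at_top[OF tendsto_const filterlim_ident])
    have "- 1 + s \<le> 1 + (s - 1)\<^sup>2" for s :: real
      using zero_le_power2[of "s - 1 - 1 / 2"] by (simp add: power2_eq_square algebra_simps)
    then show "eventually (\<lambda>s::real. - 1 + s \<le> 1 + (s - 1)\<^sup>2) at_top" by simp
  qed
  then have "((\<lambda>s::real. 1 - inverse (1 + (s - 1)\<^sup>2)) \<longlongrightarrow> 1 - 0) at_top"
    by (intro tendsto_diff tendsto_const tendsto_inverse_0_at_top)
  moreover have "eventually (\<lambda>s. 1 - inverse (1 + (s - 1)\<^sup>2) = ramp s) at_top"
    using eventually_ge_at_top[of 1]
  proof eventually_elim
    case (elim s)
    have "1 + (s - 1)\<^sup>2 > 0" by (simp add: add_pos_nonneg)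
    with elim show ?case by (simp add: ramp_def divide_simps)
  qed
  ultimately show ?thesis by (simp add: filterlim_cong[OF refl refl])
qed

lemma has_real_derivative_max_0_square:
  "((\<lambda>s::real. (max 0 s)\<^sup>2) has_real_derivative 2 * max 0 s) (at s)"
proof -
  have eq: "(\<lambda>s::real. (max 0 s)\<^sup>2) = (\<lambda>s. (s\<^sup>2 + s * \<bar>s\<bar>) / 2)"
    by (auto simp: fun_eq_iff max_def power2_eq_square)
  consider "s > 0" | "s < 0" | "s = 0" by linarith
  then show ?thesis
  proof cases
    case 1
    have "((\<lambda>s::real. s\<^sup>2) has_real_derivative 2 * s) (at s)"
      by (auto intro!: derivative_eq_intros)
    then have "((\<lambda>s::real. (max 0 s)\<^sup>2) has_real_derivative 2 * s) (at s)"
      by (rule has_field_derivative_transform_within_open[of _ _ _ "{0<..}"]) (use 1 in simp_all)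
    with 1 show ?thesis by simp
  next
    case 2
    have "((\<lambda>s::real. (max 0 s)\<^sup>2) has_real_derivative 0) (at s)"
      by (rule has_field_derivative_transform_within_open[of "\<lambda>s. 0" _ _ "{..<0}"])
        (use 2 in simp_all)
    with 2 show ?thesis by simp
  next
    case 3
    have "((\<lambda>h::real. (max 0 h)\<^sup>2 / h) \<longlongrightarrow> 0) (at 0)"
    proof (rule Lim_null_comparison)
      show "eventually (\<lambda>h. norm ((max 0 h)\<^sup>2 / h) \<le> \<bar>h\<bar>) (at (0::real))"
        by (auto simp: max_def power2_eq_square)
      show "((\<lambda>h::real. \<bar>h\<bar>) \<longlongrightarrow> 0) (at 0)"
        by (rule tendsto_rabs_zero) simp
    qed
    with 3 show ?thesis by (simp add: DERIV_def)
  qed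
qed

lemma ramp_C1: "\<exists>\<rho>'. (\<forall>s. (ramp has_real_derivative \<rho>' s) (at s)) \<and> continuous_on UNIV \<rho>'"
proof (intro exI conjI allI)
  let ?q = "\<lambda>s::real. (max 0 (s - 1))\<^sup>2"
  have q: "(?q has_real_derivative 2 * max 0 (s - 1)) (at s)" for s
  proof -
    have "((\<lambda>s. s - 1) has_real_derivative 1) (at s)" by (auto intro!: derivative_eq_intros)
    from DERIV_chain2[OF has_real_derivative_max_0_square this] show ?thesis by simp
  qed
  have pos: "1 + ?q s \<noteq> 0" for s by (smt (verit) zero_le_power2)
  show "(ramp has_real_derivative (2 * max 0 (s - 1) * (1 + ?q s) - ?q s * (2 * max 0 (s - 1)))
      / ((1 + ?q s) * (1 + ?q s))) (at s)" for s
    unfolding ramp_def[abs_def]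
  proof (rule DERIV_divide)
    from DERIV_add[OF DERIV_const q, of 1]
    show "((\<lambda>s. 1 + ?q s) has_real_derivative 2 * max 0 (s - 1)) (at s)" by simp
  qed (rule q pos)+
  show "continuous_on UNIV (\<lambda>s. (2 * max 0 (s - 1) * (1 + ?q s) - ?q s * (2 * max 0 (s - 1)))
      / ((1 + ?q s) * (1 + ?q s)))"
    by (intro continuous_intros) (use pos in auto)
qed

text \<open>A polyhedron is \<open>{x. \<forall>h. a h \<bullet> x \<le> b h}\<close>, so products of ramps in the slacks
  \<open>b h - a h \<bullet> x\<close> of its finitely many inequalities exhaust its interior from within.\<close>

lemma polyhedron_cutoffs:
  fixes S :: "(real^'n) set"
  assumes "polyhedron S"
  obtains \<theta> :: "nat \<Rightarrow> real^'n \<Rightarrow> real"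
  where "\<And>n. C1 (\<theta> n)" "\<And>n x. 0 \<le> \<theta> n x" "\<And>n x. \<theta> n x \<le> 1"
    "\<And>n. closure {x. \<theta> n x \<noteq> 0} \<subseteq> interior S"
    "\<And>x. x \<in> interior S \<Longrightarrow> (\<lambda>n. \<theta> n x) \<longlonglongrightarrow> 1"
proof -
  obtain F where F: "finite F" "S = \<Inter>F" and half: "\<forall>h\<in>F. \<exists>a b. a \<noteq> 0 \<and> h = {x. a \<bullet> x \<le> b}"
    using assms unfolding polyhedron_def by blast
  then obtain a b where ab: "\<And>h. h \<in> F \<Longrightarrow> a h \<noteq> 0 \<and> h = {x. a h \<bullet> x \<le> b h}"
    by metis
  define d where "d h x = b h - a h \<bullet> x" for h and x :: "real^'n"
  define \<theta> where "\<theta> n x = (\<Prod>h\<in>F. ramp (real (Suc n) * d h x))" for n x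
  obtain \<rho>' where \<rho>': "\<And>s. (ramp has_real_derivative \<rho>' s) (at s)" "continuous_on UNIV \<rho>'"
    using ramp_C1 by blast
  show ?thesis
  proof
    show "C1 (\<theta> n)" for n
    proof -
      have "C1 (\<lambda>x. ramp (real (Suc n) * d h x))" for h
      proof -
        have "bounded_linear (\<lambda>x. (- real (Suc n)) * (a h \<bullet> x))"
          by (intro bounded_linear_const_mult bounded_linear_inner_right)
        from C1_compose_affine[OF \<rho>' this, of "real (Suc n) * b h"] show ?thesis
          by (simp add: d_def algebra_simps)
      qed
      then show ?thesis unfolding \<theta>_def[abs_def] by (intro C1_prod)
    qed
    show "0 \<le> \<theta> n x" "\<theta> n x \<le> 1" for n x
      by (auto simp: \<theta>_def ramp_nonneg ramp_le_1 intro: prod_nonneg prod_le_1)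
    show "closure {x. \<theta> n x \<noteq> 0} \<subseteq> interior S" for n
    proof -
      let ?C = "\<Inter>h\<in>F. {x. 1 \<le> real (Suc n) * d h x}" and ?O = "\<Inter>h\<in>F. {x. a h \<bullet> x < b h}"
      have "{x. \<theta> n x \<noteq> 0} \<subseteq> ?C"
      proof clarify
        fix x h assume "\<theta> n x \<noteq> 0" "h \<in> F"
        then have "ramp (real (Suc n) * d h x) \<noteq> 0" using F(1) by (auto simp: \<theta>_def)
        then show "1 \<le> real (Suc n) * d h x" using ramp_eq_0 by (metis linear)
      qed
      moreover have "closed ?C"
        unfolding d_def by (intro closed_INT ballI closed_Collect_le continuous_intros)
      ultimately have "closure {x. \<theta> n x \<noteq> 0} \<subseteq> ?C" by (rule closure_minimal)
      also have "?C \<subseteq> ?O"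
      proof clarify
        fix x h assume "x \<in> ?C" "h \<in> F"
        then have "0 < real (Suc n) * d h x" by fastforce
        then show "a h \<bullet> x < b h" by (simp add: zero_less_mult_iff d_def)
      qed
      also have "?O \<subseteq> interior S"
      proof (rule interior_maximal)
        show "?O \<subseteq> S"
        proof
          fix x assume x: "x \<in> ?O"
          have "x \<in> h" if "h \<in> F" for h
          proof -
            have "x \<in> {x. a h \<bullet> x \<le> b h}" using x that by (auto intro: less_imp_le)
            then show ?thesis using ab[OF that] by simp
          qed
          with F(2) show "x \<in> S" by blast
        qed
        show "open ?O" by (intro open_INT F(1) ballI open_halfspace_lt)
      qed
      finally show ?thesis .
    qed
    show "(\<lambda>n. \<theta> n x) \<longlonglongrightarrow> 1" if x: "x \<in> interior S" for x
    proof -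
      have "(\<lambda>n. ramp (real (Suc n) * d h x)) \<longlonglongrightarrow> 1" if h: "h \<in> F" for h
      proof (rule filterlim_compose[OF ramp_tendsto_1])
        have "S \<subseteq> {x. a h \<bullet> x \<le> b h}" using F(2) h ab[OF h] by blast
        then have "x \<in> interior {x. a h \<bullet> x \<le> b h}" using x interior_mono by blast
        then have "x \<in> {x. a h \<bullet> x < b h}"
          by (simp only: interior_halfspace_le[OF conjunct1[OF ab[OF h]]])
        then have "0 < d h x" by (simp add: d_def)
        then have "LIM n sequentially. d h x * real (Suc n) :> at_top"
          by (intro filterlim_tendsto_pos_mult_at_top[OF tendsto_const]
              filterlim_compose[OF filterlim_real_sequentially filterlim_Suc])
        then show "LIM n sequentially. real (Suc n) * d h x :> at_top" by (simp only: mult.commute)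
      qed
      then have "(\<lambda>n. \<theta> n x) \<longlonglongrightarrow> (\<Prod>h\<in>F. 1)"
        unfolding \<theta>_def by (intro tendsto_prod)
      then show ?thesis by simp
    qed
  qed
qed

section \<open>Weak divergence of piecewise solenoidal fields\<close>

lemma test_fun_iff_C1:
  "test_fun U \<phi> \<longleftrightarrow> C1 \<phi> \<and> compact (closure {x. \<phi> x \<noteq> 0}) \<and> closure {x. \<phi> x \<noteq> 0} \<subseteq> U"
  by (auto simp: test_fun_def C1_def)

lemma test_fun_bounded:
  assumes "test_fun U \<phi>"
  obtains M where "\<And>x. \<bar>\<phi> x\<bar> \<le> M"
proof -
  let ?K = "closure {x. \<phi> x \<noteq> 0}"
  have "bounded (\<phi> ` ?K)"
    using assms by (intro compact_imp_bounded compact_continuous_image C1_continuous)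
      (auto simp: test_fun_iff_C1)
  then obtain M where "0 < M" "\<forall>y\<in>\<phi> ` ?K. norm y \<le> M" unfolding bounded_pos by blast
  then have "\<bar>\<phi> x\<bar> \<le> M" for x
    using closure_subset[of "{x. \<phi> x \<noteq> 0}"] by (cases "\<phi> x = 0") auto
  with that show ?thesis .
qed

text \<open>Domination by \<open>\<bar>w\<bar> \<le> 1 + w\<^sup>2\<close>, which is integrable on sets of finite measure.\<close>

lemma L2_on_mult_bounded_integrable:
  fixes w \<phi> :: "real^'n \<Rightarrow> real"
  assumes w: "L2_on lebesgue U w" and U: "U \<in> lmeasurable"
    and \<phi>: "\<phi> \<in> borel_measurable lebesgue" and M: "\<And>x. \<bar>\<phi> x\<bar> \<le> M"
  shows "set_integrable lebesgue U (\<lambda>x. w x * \<phi> x)"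
  unfolding set_integrable_def
proof (rule Bochner_Integration.integrable_bound)
  have "integrable lebesgue (\<lambda>x. indicator U x *\<^sub>R (norm (w x))\<^sup>2)"
    using w by (simp add: L2_on_def set_integrable_def)
  moreover have "integrable lebesgue (indicator U :: real^'n \<Rightarrow> real)"
    using U by (intro integrable_real_indicator) (auto simp: fmeasurable_def)
  ultimately show "integrable lebesgue (\<lambda>x. M * (indicator U x + indicator U x *\<^sub>R (norm (w x))\<^sup>2))"
    by (intro integrable_mult_right Bochner_Integration.integrable_add)
  have "(\<lambda>x. (indicator U x *\<^sub>R w x) * \<phi> x) \<in> borel_measurable lebesgue"
    using w \<phi> by (intro borel_measurable_times) (auto simp: L2_on_def set_borel_measurable_def)
  then show "(\<lambda>x. indicator U x *\<^sub>R (w x * \<phi> x)) \<in> borel_measurable lebesgue"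
    by (simp add: mult.assoc)
  have "\<bar>w x\<bar> * \<bar>\<phi> x\<bar> \<le> M * (1 + (w x)\<^sup>2)" for x
  proof -
    have "0 \<le> M" using M[of x] by linarith
    have "0 \<le> (\<bar>w x\<bar> - 1)\<^sup>2" by simp
    then have "\<bar>w x\<bar> \<le> 1 + (w x)\<^sup>2"
      by (simp add: power2_diff)
    then have "\<bar>w x\<bar> * \<bar>\<phi> x\<bar> \<le> (1 + (w x)\<^sup>2) * M"
      using M[of x] \<open>0 \<le> M\<close> by (intro mult_mono) auto
    then show ?thesis by (simp add: mult.commute)
  qed
  moreover have "M * (1 + (w x)\<^sup>2) \<le> \<bar>M * (1 + (w x)\<^sup>2)\<bar>" for x by (rule abs_ge_self)
  ultimately have "\<bar>w x\<bar> * \<bar>\<phi> x\<bar> \<le> \<bar>M * (1 + (w x)\<^sup>2)\<bar>" for x by (rule order_trans)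
  then show "AE x in lebesgue. norm (indicator U x *\<^sub>R (w x * \<phi> x))
      \<le> norm (M * (indicator U x + indicator U x *\<^sub>R (norm (w x))\<^sup>2))"
    by (intro always_eventually allI) (simp add: indicator_def abs_mult)
qed

text \<open>Inside a cell the field coincides with a \<open>C1\<close> solenoidal one, so the weak divergence \<open>w\<close> tested with a
  function supported there vanishes.  The cutoffs transfer this to the restriction of an arbitrary
  test function to the cell.\<close>

lemma weak_div_integral_cell_eq_0:
  fixes u v :: "real^'n \<Rightarrow> real^'n" and T :: "(real^'n) set"
  assumes U: "U \<in> lmeasurable" and w: "L2_on lebesgue U w" and div: "has_weak_div U u w"
    and T: "polyhedron T" "interior T \<subseteq> U"
    and v: "\<And>i. C1 (\<lambda>x. v x $ i)" "\<And>x. x \<in> interior T \<Longrightarrow> u x = v x"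
      "\<And>x. x \<in> interior T \<Longrightarrow> dvg v x = 0"
    and \<phi>: "test_fun U \<phi>"
  shows "(LINT x:interior T|lebesgue. w x * \<phi> x) = 0"
proof -
  obtain \<theta> :: "nat \<Rightarrow> real^'n \<Rightarrow> real" where \<theta>: "\<And>n. C1 (\<theta> n)" "\<And>n x. 0 \<le> \<theta> n x" "\<And>n x. \<theta> n x \<le> 1"
    "\<And>n. closure {x. \<theta> n x \<noteq> 0} \<subseteq> interior T"
    "\<And>x. x \<in> interior T \<Longrightarrow> (\<lambda>n. \<theta> n x) \<longlonglongrightarrow> 1"
    using polyhedron_cutoffs[OF T(1)] by metis
  have \<phi>': "C1 \<phi>" "compact (closure {x. \<phi> x \<noteq> 0})" using \<phi> by (auto simp: test_fun_iff_C1)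
  obtain M where M: "\<And>x. \<bar>\<phi> x\<bar> \<le> M" using test_fun_bounded[OF \<phi>] by blast
  have C1_meas: "f \<in> borel_measurable lebesgue" if "C1 f" for f :: "real^'n \<Rightarrow> real"
    using borel_measurable_continuous_onI[OF C1_continuous[OF that]]
    by (simp add: measurable_completion)
  have int: "set_integrable lebesgue (interior T) (\<lambda>x. w x * \<phi> x)"
    by (rule set_integrable_subset[OF L2_on_mult_bounded_integrable[OF w U C1_meas[OF \<phi>'(1)] M]])
       (use T(2) in auto)
  let ?f = "\<lambda>n x. indicator (interior T) x *\<^sub>R (w x * \<phi> x) * \<theta> n x"
  have zero: "(\<integral>x. ?f n x \<partial>lebesgue) = 0" for n
  proof -
    let ?\<psi> = "\<lambda>x. \<phi> x * \<theta> n x"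
    have sub: "closure {x. ?\<psi> x \<noteq> 0} \<subseteq> closure {x. \<phi> x \<noteq> 0}"
        "closure {x. ?\<psi> x \<noteq> 0} \<subseteq> closure {x. \<theta> n x \<noteq> 0}"
      by (intro closure_mono; simp add: subset_iff)+
    have supp: "closure {x. ?\<psi> x \<noteq> 0} \<subseteq> interior T" using sub(2) \<theta>(4) by (rule order_trans)
    have C: "C1 ?\<psi>" by (rule C1_mult[OF \<phi>'(1) \<theta>(1)])
    have cpt: "compact (closure {x. ?\<psi> x \<noteq> 0})"
      using compact_Int_closed[OF \<phi>'(2) closed_closure[of "{x. ?\<psi> x \<noteq> 0}"]]
      by (simp only: Int_absorb1[OF sub(1)])
    have "test_fun U ?\<psi>"
      unfolding test_fun_iff_C1 by (intro conjI C cpt order_trans[OF supp T(2)])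
    then have eq: "(LINT x:U|lebesgue. u x \<bullet> grad ?\<psi> x) = - (LINT x:U|lebesgue. w x * ?\<psi> x)"
      using div by (auto simp: has_weak_div_def)
    have "(LINT x:U|lebesgue. u x \<bullet> grad ?\<psi> x) = (\<integral>x. v x \<bullet> grad ?\<psi> x \<partial>lebesgue)"
      unfolding set_lebesgue_integral_def
    proof (rule Bochner_Integration.integral_cong[OF refl])
      fix x
      show "indicator U x *\<^sub>R (u x \<bullet> grad ?\<psi> x) = v x \<bullet> grad ?\<psi> x"
      proof (cases "x \<in> interior T")
        case True
        then show ?thesis using T(2) v(2) by (auto simp: indicator_def)
      next
        case False
        then have "grad ?\<psi> x = 0" using supp by (intro grad_eq_0_outside_support) (rule contra_subsetD)
        then show ?thesis by simp
      qed
    qed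
    also have "\<dots> = 0"
    proof (rule integral_solenoidal_inner_grad_eq_0[OF C _ v(1)])
      show "bounded {x. ?\<psi> x \<noteq> 0}"
        by (rule bounded_subset[OF compact_imp_bounded[OF cpt] closure_subset])
      show "dvg v x = 0" if "?\<psi> x \<noteq> 0" for x
        by (rule v(3), rule subsetD[OF order_trans[OF closure_subset supp]]) (use that in simp)
    qed
    finally have "(LINT x:U|lebesgue. w x * ?\<psi> x) = 0" using eq by simp
    moreover have "indicator U x *\<^sub>R (w x * ?\<psi> x) = ?f n x" for x
      using T(2) \<theta>(4)[of n] closure_subset[of "{x. \<theta> n x \<noteq> 0}"]
      by (cases "\<theta> n x = 0") (auto simp: indicator_def)
    ultimately show ?thesis unfolding set_lebesgue_integral_def by (simp only:)
  qed
  have "(\<lambda>n. \<integral>x. ?f n x \<partial>lebesgue) \<longlonglongrightarrow> (\<integral>x. indicator (interior T) x *\<^sub>R (w x * \<phi> x) \<partial>lebesgue)"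
  proof (rule integral_dominated_convergence)
    show intf: "integrable lebesgue (\<lambda>x. norm (indicator (interior T) x *\<^sub>R (w x * \<phi> x)))"
      using int by (simp add: set_integrable_def)
    show m: "(\<lambda>x. indicator (interior T) x *\<^sub>R (w x * \<phi> x)) \<in> borel_measurable lebesgue"
      using int by (auto simp: set_integrable_def)
    show "?f n \<in> borel_measurable lebesgue" for n
      by (intro borel_measurable_times m C1_meas \<theta>(1))
    show "AE x in lebesgue. (\<lambda>n. ?f n x) \<longlonglongrightarrow> indicator (interior T) x *\<^sub>R (w x * \<phi> x)"
    proof (intro always_eventually allI)
      fix x show "(\<lambda>n. ?f n x) \<longlonglongrightarrow> indicator (interior T) x *\<^sub>R (w x * \<phi> x)"
        using tendsto_mult[OF tendsto_const \<theta>(5)[of x], of "w x * \<phi> x"]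
        by (cases "x \<in> interior T") auto
    qed
    show "AE x in lebesgue. norm (?f n x) \<le> norm (indicator (interior T) x *\<^sub>R (w x * \<phi> x))" for n
      using \<theta>(2,3)[of n] by (intro always_eventually allI) (simp add: abs_mult mult_left_le)
  qed
  then have "0 = (\<integral>x. indicator (interior T) x *\<^sub>R (w x * \<phi> x) \<partial>lebesgue)"
    by (simp only: zero LIMSEQ_const_iff)
  then show ?thesis unfolding set_lebesgue_integral_def by (rule sym)
qed

text \<open>Piecewise solenoidality alone would allow normal fluxes to jump across faces.  The hypothesis
  \<open>Hdiv\<close> excludes this: the weak divergence is a function, so it is determined off the faces, which
  form a null set.\<close>

lemma has_weak_div_0_if_piecewise_solenoidal:
  fixes u :: "real^'n \<Rightarrow> real^'n"
  assumes U: "U \<in> lmeasurable" and u: "Hdiv U u"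
    and \<T>: "finite \<T>" "\<And>T. T \<in> \<T> \<Longrightarrow> polyhedron T" "\<And>T. T \<in> \<T> \<Longrightarrow> interior T \<subseteq> U"
      "disjoint_family_on interior \<T>" "U \<subseteq> \<Union>\<T>"
    and piece: "\<And>T. T \<in> \<T> \<Longrightarrow> \<exists>v. (\<forall>i. C1 (\<lambda>x. v x $ i)) \<and> (\<forall>x\<in>interior T. u x = v x \<and> dvg v x = 0)"
  shows "has_weak_div U u (\<lambda>x. 0)"
proof -
  obtain w where w: "L2_on lebesgue U w" and div: "has_weak_div U u w"
    using u by (auto simp: Hdiv_def)
  have "(LINT x:U|lebesgue. w x * \<phi> x) = 0" if \<phi>: "test_fun U \<phi>" for \<phi>
  proof -
    let ?V = "\<Union>T\<in>\<T>. interior T"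
    have cell: "(LINT x:interior T|lebesgue. w x * \<phi> x) = 0" if "T \<in> \<T>" for T
      using piece[OF that] weak_div_integral_cell_eq_0[OF U w div \<T>(2,3)[OF that] _ _ _ \<phi>] by blast
    obtain M where M: "\<And>x. \<bar>\<phi> x\<bar> \<le> M" using test_fun_bounded[OF \<phi>] by blast
    have m: "\<phi> \<in> borel_measurable lebesgue"
      using \<phi> borel_measurable_continuous_onI[OF C1_continuous[of \<phi>]]
      by (simp add: measurable_completion test_fun_iff_C1)
    have int: "set_integrable lebesgue U (\<lambda>x. w x * \<phi> x)"
      by (rule L2_on_mult_bounded_integrable[OF w U m M])
    have intT: "set_integrable lebesgue (interior T) (\<lambda>x. w x * \<phi> x)" if "T \<in> \<T>" for T
      by (rule set_integrable_subset[OF int]) (use \<T>(3) that in auto)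
    have intV: "set_integrable lebesgue ?V (\<lambda>x. w x * \<phi> x)"
      by (rule set_integrable_UN[OF \<T>(1) intT]) auto
    have "negligible (\<Union>T\<in>\<T>. frontier T)"
      using \<T>(1,2) by (intro negligible_Union)
        (auto intro: negligible_convex_frontier polyhedron_imp_convex)
    then have "AE x in lebesgue. x \<notin> (\<Union>T\<in>\<T>. frontier T)"
      by (intro AE_not_in) (simp add: negligible_iff_null_sets)
    then have ae: "AE x in lebesgue. x \<in> ?V \<longleftrightarrow> x \<in> U"
    proof eventually_elim
      case (elim x)
      then have "x \<in> interior T" if "T \<in> \<T>" "x \<in> T" for T
        using that closure_subset[of T] by (auto simp: frontier_def)
      with \<T>(3,5) show ?case by blast
    qed
    have "(LINT x:U|lebesgue. w x * \<phi> x) = (LINT x:?V|lebesgue. w x * \<phi> x)"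
      using int intV ae
      by (intro set_integral_cong_set) (auto simp: set_integrable_def set_borel_measurable_def)
    also have "\<dots> = (\<Sum>T\<in>\<T>. LINT x:interior T|lebesgue. w x * \<phi> x)"
      by (intro set_integral_finite_Union \<T> intT) auto
    finally show ?thesis by (simp add: cell)
  qed
  with div show ?thesis by (simp add: has_weak_div_def)
qed

section \<open>Meshes and the stabilisation form\<close>

lemma mesh_cell:
  fixes D :: "('n::finite) darcy"
  assumes "mesh_family D h0 H" "h \<in> H" "T \<in> mesh D h"
  shows "polyhedron T" "compact T" "closure (interior T) = T"
proof -
  have T: "int CARD('n) simplex T"
    using assms by (auto simp: mesh_family_def)
  show "polyhedron T" "compact T"
    using T by (auto intro: simplex_imp_polyhedron compact_simplex)
  have "aff_dim T = int CARD('n)" using T by (rule aff_dim_simplex)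
  then have "affine hull T = UNIV" using aff_dim_eq_full[of T] by simp
  then have "rel_interior T = interior T" by (rule rel_interior_interior)
  then show "closure (interior T) = T"
    using convex_closure_rel_interior[OF convex_simplex[OF T]] closed_simplex[OF T] by simp
qed

lemma triangulation_disjoint_interiors:
  assumes "triangulation \<T>"
  shows "disjoint_family_on interior \<T>"
  unfolding disjoint_family_on_def
proof (intro ballI impI)
  fix S T assume ST: "S \<in> \<T>" "T \<in> \<T>" "S \<noteq> T"
  show "interior S \<inter> interior T = {}"
  proof (rule ccontr)
    assume "interior S \<inter> interior T \<noteq> {}"
    then have meet: "(S \<inter> T) \<inter> interior S \<noteq> {}" "(S \<inter> T) \<inter> interior T \<noteq> {}"
      using interior_subset by blast+
    have face: "(A \<inter> B) face_of A" if "A \<in> \<T>" "B \<in> \<T>" for A B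
      using assms that by (auto simp: triangulation_def)
    have faces: "(S \<inter> T) face_of S" "(S \<inter> T) face_of T"
      using face[OF ST(1,2)] face[OF ST(2,1)] by (simp_all only: Int_commute)
    from face_of_disjoint_interior[OF faces(1)] face_of_disjoint_interior[OF faces(2)] meet
    have "S \<inter> T = S" "S \<inter> T = T" by blast+
    with ST(3) show False by simp
  qed
qed

lemma dvg_cong_open:
  assumes "open S" "x \<in> S" "\<And>y. y \<in> S \<Longrightarrow> u y = v y" "\<And>i. (\<lambda>y. v y $ i) differentiable at x"
  shows "dvg u x = dvg v x"
  unfolding dvg_def dir_deriv_def
  using assms by (intro sum.cong refl fun_cong[OF sym[OF frechet_derivative_transform_within_open]]) auto

lemma form_sb_dvg_nonneg:
  assumes "0 \<le> h" "\<And>i j. i \<in> {1, 2} \<Longrightarrow> 0 \<le> tau_b D i j"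
  shows "0 \<le> form_sb D h kh u (\<lambda>i. dvg (u i))"
  unfolding form_sb_def set_lebesgue_integral_def
  using assms
  by (intro sum_nonneg mult_nonneg_nonneg Bochner_Integration.integral_nonneg scaleR_nonneg_nonneg
      zero_le_square zero_le_power indicator_pos_le) auto

lemma partials_const:
  fixes c :: "'b::real_normed_vector"
  obtains c' :: 'b where "partials is (\<lambda>x::real^'n. c) = (\<lambda>x. c')"
proof (induction "is" arbitrary: thesis)
  case (Cons i "is")
  obtain c' where "partials is (\<lambda>x::real^'n. c) = (\<lambda>x. c')" by (rule Cons.IH)
  then have "partials (i # is) (\<lambda>x::real^'n. c) = partial i (\<lambda>x. c')"
    by (simp add: partials_def)
  also have "\<dots> = (\<lambda>x. 0)" by (simp add: dir_deriv_def fun_eq_iff)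
  finally show ?case by (rule Cons.prems)
qed (auto simp: partials_def)

lemma elem_trace_const:
  assumes "x \<in> closure (interior T)"
  shows "elem_trace T (\<lambda>x. c) x = c"
proof -
  have "x islimpt interior T"
    using assms open_interior[of T] interior_limit_point[of x "interior T"]
    by (cases "x \<in> interior T") (auto simp: closure_def)
  then show ?thesis
    unfolding elem_trace_def by (intro tendsto_Lim) (auto simp: trivial_limit_within)
qed

text \<open>Turns the equation for the constant \<open>1\<close> into a statement about the mean of the divergence.
  The trace of a constant on a face is that constant because the face lies in the closure of the
  interior of each adjacent element, so that the limits defining the traces are unique.\<close>

lemma form_sb_const:
  fixes D :: "('n::finite) darcy"
  assumes "mesh_family D h0 H" "h \<in> H"
  shows "form_sb D h kh u (\<lambda>i x. c) = 0"
proof -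
  have jump: "face_jump D h i F (partials is (\<lambda>x. c)) x = 0"
    if F: "F \<in> stab_faces D h i" and x: "x \<in> F" for i F "is" x
  proof -
    obtain c' where c': "partials is (\<lambda>x::real^'n. c) = (\<lambda>x. c')" by (rule partials_const)
    define P where "P = (SOME P. share_face D h i F P)"
    have "\<exists>P. share_face D h i F P" using F by (simp add: stab_faces_def)
    then have "share_face D h i F P" unfolding P_def by (rule someI_ex)
    then obtain T T' where P: "P = (T, T')" and TT: "T \<in> mesh D h" "T' \<in> mesh D h" "F \<subseteq> T" "F \<subseteq> T'"
      by (cases P) (auto simp: share_face_def act_mesh_def dest: facet_of_imp_subset)
    have "elem_trace T (\<lambda>x. c') x = c'" "elem_trace T' (\<lambda>x. c') x = c'"
      using TT x mesh_cell(3)[OF assms TT(1)] mesh_cell(3)[OF assms TT(2)]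
      by (auto intro!: elem_trace_const)
    then show ?thesis by (simp add: face_jump_def c' flip: P_def) (simp add: P)
  qed
  have "(LINT x:F|surf. \<Sum>is | length is = j.
        face_jump D h i F (partials is (dvg (u i))) x * face_jump D h i F (partials is (\<lambda>x. c)) x) = 0"
    if "F \<in> stab_faces D h i" for i F j
  proof -
    have "(\<lambda>x. indicator F x *\<^sub>R (\<Sum>is | length is = j. face_jump D h i F (partials is (dvg (u i))) x *
        face_jump D h i F (partials is (\<lambda>x. c)) x)) = (\<lambda>x. 0)"
      using jump[OF that] by (auto simp: fun_eq_iff indicator_def)
    then show ?thesis by (simp add: set_lebesgue_integral_def)
  qed
  then show ?thesis by (simp add: form_sb_def)
qed

section \<open>Vanishing of the discrete divergence\<close>

lemma negligible_open_imp_empty: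
  fixes U :: "'a::euclidean_space set"
  assumes "open U" "negligible U"
  shows "U = {}"
proof (rule ccontr)
  assume "U \<noteq> {}"
  then obtain a e where e: "0 < e" "ball a e \<subseteq> U"
    using assms(1) unfolding open_contains_ball by blast
  have "negligible (ball a e)" using e(2) assms(2) by (rule negligible_subset[rotated])
  then have "measure lebesgue (ball a e) = 0" by (rule negligible_imp_measure0)
  then show False using content_ball_pos[OF e(1), of a] by simp
qed

lemma real_polynomial_function_zero_if_AE_zero:
  fixes p :: "real^'n \<Rightarrow> real"
  assumes p: "real_polynomial_function p" and U: "open U" "U \<noteq> {}"
    and ae: "AE x in lebesgue. x \<in> U \<longrightarrow> p x = 0"
  shows "p y = 0"
proof -
  have cont: "continuous_on UNIV p" by (rule C1_continuous[OF C1_real_polynomial_function[OF p]])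
  have "open (U \<inter> p -` (- {0}))"
    by (intro open_Int U(1) open_vimage cont) auto
  moreover have "negligible (U \<inter> p -` (- {0}))"
  proof -
    obtain N where N: "N \<in> null_sets lebesgue" "{x. \<not> (x \<in> U \<longrightarrow> p x = 0)} \<subseteq> N"
      using ae by (auto simp: eventually_ae_filter)
    have "U \<inter> p -` (- {0}) = {x. \<not> (x \<in> U \<longrightarrow> p x = 0)}" by (simp add: set_eq_iff)
    also note N(2)
    finally show ?thesis
      using N(1) unfolding negligible_iff_null_sets[symmetric] by (rule negligible_subset[rotated])
  qed
  ultimately have empty: "U \<inter> p -` (- {0}) = {}"
    by (rule negligible_open_imp_empty)
  have zero: "p x = 0" if "x \<in> U" for x
    using equalityD1[OF empty] that by (simp add: subset_iff)
  obtain a where "a \<in> U" using U(2) by blast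
  then show ?thesis
    by (rule real_polynomial_function_zero_if_zero_on_open[OF p U(1) _ zero])
qed

text \<open>Up to the faces, which form a null set, the function coincides on each cell with a continuous
  one; completeness of Lebesgue measure gives measurability on all of \<open>S\<close>.\<close>

lemma piecewise_continuous_integrable:
  fixes f :: "real^'n \<Rightarrow> real"
  assumes \<T>: "finite \<T>" "\<And>T. T \<in> \<T> \<Longrightarrow> compact T \<and> convex T" and S: "S \<in> sets lebesgue" "S \<subseteq> \<Union>\<T>"
    and piece: "\<And>T. T \<in> \<T> \<Longrightarrow> \<exists>g. continuous_on UNIV g \<and> (\<forall>x\<in>interior T. f x = g x)"
  shows "set_integrable lebesgue S f"
proof -
  let ?V = "\<Union>T\<in>\<T>. interior T \<inter> S"
  have "set_integrable lebesgue (interior T \<inter> S) f" if T: "T \<in> \<T>" for T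
  proof -
    obtain g where g: "continuous_on UNIV g" "\<forall>x\<in>interior T. f x = g x" using piece[OF T] by blast
    have "set_integrable lebesgue T g"
      using borel_integrable_compact[of T g] \<T>(2)[OF T] continuous_on_subset[OF g(1), of T]
      by (simp add: set_integrable_def integrable_completion)
    then have "set_integrable lebesgue (interior T \<inter> S) g"
      by (rule set_integrable_subset) (use S interior_subset in \<open>auto\<close>)
    also have "set_integrable lebesgue (interior T \<inter> S) g = set_integrable lebesgue (interior T \<inter> S) f"
      using g(2) by (intro set_integrable_cong) auto
    finally show ?thesis .
  qed
  then have V: "set_integrable lebesgue ?V f"
    by (intro set_integrable_UN \<T>(1)) (use S in auto)
  have null: "negligible (\<Union>T\<in>\<T>. frontier T)"
    using \<T> by (intro negligible_Union) (auto intro: negligible_convex_frontier)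
  have "S - ?V \<subseteq> (\<Union>T\<in>\<T>. frontier T)"
  proof
    fix x assume x: "x \<in> S - ?V"
    then obtain T where T: "T \<in> \<T>" "x \<in> T" using S(2) by blast
    then have "x \<in> frontier T"
      using x subsetD[OF closure_subset T(2)] by (auto simp: frontier_def)
    with T(1) show "x \<in> (\<Union>T\<in>\<T>. frontier T)" by blast
  qed
  then have "negligible {x \<in> S - ?V. f x \<noteq> 0}"
    by (intro negligible_subset[OF null]) auto
  moreover have "{x \<in> ?V - S. f x \<noteq> 0} = {}" by auto
  ultimately show ?thesis
    using absolutely_integrable_spike_set_eq[of ?V S f] V by simp
qed

lemma V_act_dvg_poly:
  fixes D :: "('n::finite) darcy"
  assumes "admissible_degrees fam k kh" "v \<in> V_act D h fam k i" "T \<in> act_mesh D h i"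
  shows "\<exists>p\<in>V_loc fam k. dvg p \<in> P_deg kh \<and> (\<forall>x\<in>interior T. v x = p x \<and> dvg v x = dvg p x)"
proof -
  obtain p where p: "p \<in> V_loc fam k" "\<And>x. x \<in> interior T \<Longrightarrow> v x = p x"
    using assms(2,3) unfolding V_act_def by blast
  have "(\<lambda>y. p y $ j) differentiable at x" for j x
    by (rule C1_differentiable[OF C1_real_polynomial_function[OF V_loc_real_polynomial_function[OF p(1)]]])
  then have dvg_eq: "dvg v x = dvg p x" if "x \<in> interior T" for x
    using that p(2) by (intro dvg_cong_open[of "interior T"]) auto
  show ?thesis
    using V_loc_dvg[OF assms(1) p(1)] p(2) dvg_eq by (intro bexI[OF _ p(1)]) simp
qed

theorem theorem3p2:
  fixes D :: "('n::finite) darcy"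
    and h0 h :: real and H :: "real set"
    and fam :: fe_family and k kh :: nat
    and u_h :: "nat \<Rightarrow> real ^ 'n \<Rightarrow> real ^ 'n"
    and p_h :: "nat \<Rightarrow> real ^ 'n \<Rightarrow> real"
  assumes "geometry D" and "data_ok D"
    and "mesh_family D h0 H" and "h \<in> H"
    and "admissible_degrees fam k kh"
    and g_zero: "AE x in lebesgue. x \<in> sub D 1 \<union> sub D 2 \<longrightarrow> src_g D x = 0"
    and "discrete_solution D h fam k kh u_h p_h"
    \<comment> \<open>If the pressure space is constrained, the second equation also holds for constants,
        which the constraint removes from \<open>Q_h\<close>; without this the claim fails.\<close>
    and "bdry_p D = {} \<Longrightarrow> form_B D h kh u_h (\<lambda>i x. 1) = form_G D (\<lambda>i x. 1)"
  shows "\<forall>i\<in>{1, 2}.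
           (\<forall>T\<in>act_mesh D h i. \<forall>x\<in>interior T. dvg (u_h i) x = 0) \<and>
           has_weak_div (interior (act_dom D h i)) (u_h i) (\<lambda>x. 0)"
proof -
  note mesh = assms(3,4) and deg = assms(5)
  have "\<forall>i\<in>{1, 2}. open (sub D i) \<and> connected (sub D i) \<and> sub D i \<noteq> {}"
    using assms(1) unfolding geometry_def by (elim conjE)
  moreover have "region D = sub D 1 \<union> gam D \<union> sub D 2"
    using assms(1) unfolding geometry_def by (elim conjE)
  ultimately have sub: "open (sub D i)" "sub D i \<subseteq> region D" if "i \<in> {1, 2}" for i
    using that by auto
  have "H \<subseteq> {0<..h0}"
    using mesh(1) unfolding mesh_family_def by (elim conjE)
  then have h: "0 \<le> h" using mesh(2) by auto
  have cells: "\<forall>h\<in>H. triangulation (mesh D h) \<and>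
      (\<forall>T\<in>mesh D h. int CARD('n) simplex T) \<and>
      \<Union>(mesh D h) = closure (region D) \<and> h = Max (diameter ` mesh D h) \<and>
      (\<forall>T\<in>mesh D h. gam D \<inter> interior T \<noteq> {} \<longrightarrow> cut_ok (gam D) T)"
    using mesh(1) unfolding mesh_family_def by (elim conjE)
  have cover: "\<Union>(mesh D h) = closure (region D)" and tri: "triangulation (mesh D h)"
    using bspec[OF cells mesh(2)] by simp_all
  have fin: "finite (mesh D h)" using tri by (simp add: triangulation_def)
  have act_sub: "act_mesh D h i \<subseteq> mesh D h" for i by (auto simp: act_mesh_def)
  have fin_act: "finite (act_mesh D h i)" for i using finite_subset[OF act_sub fin] .
  note cell = mesh_cell[OF mesh subsetD[OF act_sub]]
  have u: "u_h i \<in> V_act D h fam k i" if "i \<in> {1, 2}" for i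
    using assms(7) that by (auto simp: discrete_solution_def V_h_def)
  have dvg_piece: "\<exists>p\<in>P_deg kh. \<forall>x\<in>interior T. dvg (u_h i) x = p x"
    if "i \<in> {1, 2}" "T \<in> act_mesh D h i" for i T
    using V_act_dvg_poly[OF deg u[OF that(1)] that(2)] by auto

  have G0: "form_G D q = 0" for q
  proof -
    have "(LINT x:sub D i|lebesgue. src_g D x * q i x) = 0" if "i \<in> {1, 2}" for i
      unfolding set_lebesgue_integral_def
    proof (rule integral_eq_zero_AE)
      show "AE x in lebesgue. indicator (sub D i) x *\<^sub>R (src_g D x * q i x) = 0"
        using g_zero by eventually_elim (use that in \<open>auto simp: indicator_def\<close>)
    qed
    then show ?thesis by (simp add: form_G_def)
  qed

  \<comment> \<open>The divergence is an admissible pressure test function; in the constrained case its mean is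
    the value of the form at the constant \<open>1\<close>, because the jumps of constants vanish.\<close>
  have Q: "(\<lambda>i. dvg (u_h i)) \<in> Q_h D h kh"
    unfolding Q_h_def
  proof (intro CollectI conjI ballI impI)
    show "dvg (u_h i) \<in> Q_act D h kh i" if "i \<in> {1, 2}" for i
      using dvg_piece[OF that] by (auto simp: Q_act_def)
    show "(\<Sum>i\<in>{1, 2}. LINT x:sub D i|lebesgue. dvg (u_h i) x) = 0" if "bdry_p D = {}"
      using assms(8)[OF that] by (simp only: G0 form_B_def form_sb_const[OF mesh]) simp
  qed

  \<comment> \<open>With the divergence as test function the form is minus a sum of nonnegative terms.\<close>
  define E where "E i = (LINT x:sub D i|lebesgue. dvg (u_h i) x * dvg (u_h i) x)" for i
  have "form_B D h kh u_h (\<lambda>i. dvg (u_h i)) = 0"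
    using assms(7) Q G0 by (simp add: discrete_solution_def)
  moreover have "0 \<le> form_sb D h kh u_h (\<lambda>i. dvg (u_h i))"
    using assms(2) by (intro form_sb_dvg_nonneg h) (auto simp: data_ok_def intro: less_imp_le)
  ultimately have "E 1 + E 2 \<le> 0" by (simp add: form_B_def E_def)
  moreover have "0 \<le> E i" for i
    unfolding E_def set_lebesgue_integral_def by (intro Bochner_Integration.integral_nonneg) simp
  ultimately have E0: "E i = 0" if "i \<in> {1, 2}" for i
    using that by (smt (verit) insertE singletonD)

  have zero: "dvg (u_h i) x = 0"
    if i: "i \<in> {1, 2}" and T: "T \<in> act_mesh D h i" and x: "x \<in> interior T" for i T x
  proof -
    \<comment> \<open>The energy identity only sees the part of the element in \<open>sub D i\<close>; the identity theorem for
      polynomials covers the rest of a cut element.\<close>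
    let ?d = "dvg (u_h i)"
    have int: "set_integrable lebesgue (sub D i) (\<lambda>x. ?d x * ?d x)"
    proof (rule piecewise_continuous_integrable[OF fin_act])
      show "compact T \<and> convex T" if "T \<in> act_mesh D h i" for T
        using cell(1,2)[OF that] by (simp add: polyhedron_imp_convex)
      show "sub D i \<in> sets lebesgue" using sub(1)[OF i] by simp
      show "sub D i \<subseteq> \<Union>(act_mesh D h i)"
        using sub(2)[OF i] cover closure_subset[of "region D"] unfolding act_mesh_def by blast
      show "\<exists>g. continuous_on UNIV g \<and> (\<forall>x\<in>interior T. ?d x * ?d x = g x)"
        if T: "T \<in> act_mesh D h i" for T
      proof -
        obtain p where p: "p \<in> P_deg kh" "\<forall>x\<in>interior T. ?d x = p x"
          using dvg_piece[OF i T] by blast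
        then show ?thesis
          by (intro exI[of _ "\<lambda>x. p x * p x"] conjI continuous_on_mult P_deg_continuous[OF p(1)]) auto
      qed
    qed
    have ae: "AE x in lebesgue. indicator (sub D i) x *\<^sub>R (?d x * ?d x) = 0"
      using E0[OF i] int integral_nonneg_eq_0_iff_AE[of lebesgue "\<lambda>x. indicator (sub D i) x *\<^sub>R (?d x * ?d x)"]
      by (simp add: E_def set_lebesgue_integral_def set_integrable_def)
    obtain p where p: "p \<in> P_deg kh" "\<forall>x\<in>interior T. ?d x = p x"
      using dvg_piece[OF i T] by blast
    have "interior T \<inter> sub D i \<noteq> {}"
      using open_Int_closure_eq_empty[OF sub(1)[OF i], of "interior T"] cell(3)[OF T] T
      by (auto simp: act_mesh_def Int_commute)
    moreover have "AE x in lebesgue. x \<in> interior T \<inter> sub D i \<longrightarrow> p x = 0"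
      using ae by eventually_elim (use p(2) in \<open>auto simp: indicator_def\<close>)
    ultimately have "p x = 0"
      using real_polynomial_function_zero_if_AE_zero[OF P_deg_real_polynomial_function[OF p(1)]
          open_Int[OF open_interior sub(1)[OF i]]] by blast
    with p(2) x show ?thesis by simp
  qed

  have "has_weak_div (interior (act_dom D h i)) (u_h i) (\<lambda>x. 0)" if i: "i \<in> {1, 2}" for i
  proof (rule has_weak_div_0_if_piecewise_solenoidal[OF _ _ fin_act])
    have "bounded (act_dom D h i)"
      unfolding act_dom_def using fin_act cell(2) by (intro bounded_Union) (auto intro: compact_imp_bounded)
    then show "interior (act_dom D h i) \<in> lmeasurable"
      by (intro lmeasurable_open bounded_interior open_interior)
    show "Hdiv (interior (act_dom D h i)) (u_h i)"
      using u[OF i] by (simp add: V_act_def)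
    show "disjoint_family_on interior (act_mesh D h i)"
      by (rule disjoint_family_on_mono[OF act_sub triangulation_disjoint_interiors[OF tri]])
    show "interior (act_dom D h i) \<subseteq> \<Union>(act_mesh D h i)"
      unfolding act_dom_def by (rule interior_subset)
    fix T assume T: "T \<in> act_mesh D h i"
    show "polyhedron T" by (rule cell(1)[OF T])
    show "interior T \<subseteq> interior (act_dom D h i)"
      unfolding act_dom_def by (intro interior_mono Union_upper T)
    obtain p where p: "p \<in> V_loc fam k"
        "\<forall>x\<in>interior T. u_h i x = p x \<and> dvg (u_h i) x = dvg p x"
      using V_act_dvg_poly[OF deg u[OF i] T] by blast
    have "C1 (\<lambda>x. p x $ j)" for j
      by (rule C1_real_polynomial_function[OF V_loc_real_polynomial_function[OF p(1)]])
    then show "\<exists>v. (\<forall>j. C1 (\<lambda>x. v x $ j)) \<and> (\<forall>x\<in>interior T. u_h i x = v x \<and> dvg v x = 0)"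
      using p(2) zero[OF i T] by (intro exI[of _ p]) auto
  qed
  with zero show ?thesis by blast
qed

end
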